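(* Let $N\ge1$, $n\ge1$ and $\kappa\ge0$. The determinant $\widetilde D_n=\det\left(\langle h_\lambda,h_\mu\rangle_h\right)_{\lambda,\mu\in\widetilde{\mathcal{P}}_n^{(N)}}$ of the Gram matrix of $\{h_\lambda:\lambda\in\widetilde{\mathcal{P}}_n^{(N)}\}$ for the inner product $\langle\cdot,\cdot\rangle_h$ satisfies \[ \widetilde D_n=\frac{D_n}{D_{n-1}}\prod_{i=1}^n\left(i\left(2n-i-1+\frac N2+N\kappa\right)\right)^{d(n-i,N)}, \] where $d(j,N)=\#\widetilde{\mathcal{P}}_j^{(N)}$ for $j\ge0$ and \[ D_k=\prod_{\lambda\in\mathcal{P}_k^{(N)}}\left(\lambda!\,\left(\kappa+\tfrac12\right)_\lambda\,m_\lambda(1^N)\right)^{-1}\qquad(k\ge0). \]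
   Context: Partitions and symmetric functions. A partition is a finite sequence $\lambda=(\lambda_1,\lambda_2,\ldots)$ of nonnegative integers with $\lambda_1\ge\lambda_2\ge\cdots\ge0$; partitions with the same nonzero components are identified (so $\lambda_i=0$ beyond the length). $|\lambda|=\sum_i\lambda_i$, $l(\lambda)$ is the number of nonzero components, $\mathcal{P}_n^{(N)}$ is the set of partitions with $|\lambda|=n$, $l(\lambda)\le N$, regarded as elements of $\mathbb{N}_0^N$ ($\mathcal{P}_0^{(N)}$ consists of the zero partition), and $\widetilde{\mathcal{P}}_n^{(N)}=\{\lambda\in\mathcal{P}_n^{(N)}:\lambda_1=\lambda_2\}$. For $\alpha\in\mathbb{N}_0^N$: $x^\alpha=\prod_i x_i^{\alpha_i}$, $\alpha!=\prod_i\alpha_i!$, $(t)_\alpha=\prod_i(t)_{\alpha_i}$ with $(t)_k=\prod_{i=1}^k(t+i-1)$, and $\alpha^+$ is $\alpha$ sorted in nonincreasing order. $m_\lambda=\sum\{x^\alpha:\alpha^+=\lambda\}$, $e_1=\sum_{i=1}^N x_i$, $\widetilde m_\lambda=e_1^{\lambda_1-\lambda_2}m_{(\lambda_2,\lambda_2,\lambda_3,\ldots)}$. The set $\{\widetilde m_\lambda:\lambda\in\mathcal{P}_n^{(N)}\}$ is a basis of the homogeneous symmetric polynomials of degree $n$, and $B(\mu,\lambda)$ is defined by $m_\lambda=\sum_{\mu\in\mathcal{P}_n^{(N)}}B(\mu,\lambda)\widetilde m_\mu$. The relation $\mu\preceq\lambda$ means $|\mu|=|\lambda|$ and $\lambda_i\le\mu_i$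 for all $i\ge2$. $1^N=(1,\ldots,1)\in\mathbb{R}^N$ and $x^2=(x_1^2,\ldots,x_N^2)$. For $\mu\in\mathcal{P}_n^{(N)}$, \[h_\mu(x)=2^{-n}\sum_{\lambda\in\mathcal{P}_n^{(N)},\ \mu\preceq\lambda}\frac{B(\mu,\lambda)}{\lambda!\,(\kappa+\frac12)_\lambda}\,\frac{m_\lambda(x^2)}{m_\lambda(1^N)}.\] Inner product. $\sigma_i$ is the reflection $(x_1,\ldots,x_N)\mapsto(x_1,\ldots,-x_i,\ldots,x_N)$. For polynomials $f$ on $\mathbb{R}^N$, $\mathcal{D}_if(x)=\frac{\partial f}{\partial x_i}(x)+\kappa\frac{f(x)-f(x\sigma_i)}{x_i}$ (these operators commute), and $\langle f,g\rangle_h=f(\mathcal{D}_1,\ldots,\mathcal{D}_N)g(x)|_{x=0}$, where $f(\mathcal{D}_1,\ldots,\mathcal{D}_N)$ is obtained by replacing each $x_i$ in $f$ by $\mathcal{D}_i$. The determinant of an empty matrix is $1$. *)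

theory Defs
  imports "HOL-Library.Poly_Mapping" "Jordan_Normal_Form.Determinant"
begin

section \<open>Polynomials\<close>

text \<open>
  A multi-index is an element of \<^typ>\<open>nat \<Rightarrow>\<^sub>0 nat\<close>, and a polynomial is a finitely supported
  function from multi-indices to coefficients, multiplied by convolution.  Indices start at \<open>0\<close>:
  the mathematical \<open>x\<^sub>1, \<dots>, x\<^sub>N\<close> are the variables \<open>0, \<dots>, N - 1\<close>, and the component
  \<open>\<alpha>\<^sub>i\<close> of a multi-index is \<open>lookup \<alpha> (i - 1)\<close>.
\<close>

type_synonym mindex = "nat \<Rightarrow>\<^sub>0 nat"
type_synonym rpoly = "mindex \<Rightarrow>\<^sub>0 real"

abbreviation coef :: "('a \<Rightarrow>\<^sub>0 'b::zero) \<Rightarrow> 'a \<Rightarrow> 'b" where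
  "coef \<equiv> Poly_Mapping.lookup"

definition cpoly :: "real \<Rightarrow> rpoly" where
  "cpoly c = Poly_Mapping.single 0 c"

definition xpow :: "mindex \<Rightarrow> rpoly" where
  "xpow \<alpha> = Poly_Mapping.single \<alpha> 1"

definition X :: "nat \<Rightarrow> rpoly" where
  "X i = xpow (Poly_Mapping.single i 1)"

definition eval_poly :: "(nat \<Rightarrow> real) \<Rightarrow> rpoly \<Rightarrow> real" where
  "eval_poly x p = (\<Sum>\<alpha>\<in>Poly_Mapping.keys p. coef p \<alpha> * (\<Prod>i\<in>Poly_Mapping.keys \<alpha>. x i ^ coef \<alpha> i))"

definition subst_poly :: "(nat \<Rightarrow> rpoly) \<Rightarrow> rpoly \<Rightarrow> rpoly" where
  "subst_poly y p = (\<Sum>\<alpha>\<in>Poly_Mapping.keys p. cpoly (coef p \<alpha>) * (\<Prod>i\<in>Poly_Mapping.keys \<alpha>. y i ^ coef \<alpha> i))"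

section \<open>Partitions and symmetric polynomials\<close>

definition weight :: "mindex \<Rightarrow> nat" where
  "weight \<alpha> = (\<Sum>i\<in>Poly_Mapping.keys \<alpha>. coef \<alpha> i)"

definition partitions :: "nat \<Rightarrow> nat \<Rightarrow> mindex set" where
  "partitions N n = {\<nu>. Poly_Mapping.keys \<nu> \<subseteq> {..<N} \<and> antimono (coef \<nu>) \<and> weight \<nu> = n}"

definition tpartitions :: "nat \<Rightarrow> nat \<Rightarrow> mindex set" where
  "tpartitions N n = {\<nu> \<in> partitions N n. coef \<nu> 0 = coef \<nu> 1}"

lemma finite_partitions: "finite (partitions N n)"
proof -
  have "partitions N n \<subseteq> (\<lambda>xs. Poly_Mapping.nth xs) ` {xs. set xs \<subseteq> {..n} \<and> length xs = N}"
  proof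
    fix l assume l: "l \<in> partitions N n"
    have le: "coef l i \<le> n" for i
    proof (cases "i \<in> Poly_Mapping.keys l")
      case True
      then have "coef l i \<le> weight l"
        unfolding weight_def by (intro member_le_sum) auto
      with l show ?thesis by (simp add: partitions_def)
    next
      case False
      then show ?thesis by (simp add: in_keys_iff)
    qed
    have "l = Poly_Mapping.nth (map (coef l) [0..<N])"
    proof (rule poly_mapping_eqI)
      fix k
      show "coef l k = coef (Poly_Mapping.nth (map (coef l) [0..<N])) k"
        using l by (cases "k < N") (auto simp: partitions_def nth.rep_eq nth_default_def in_keys_iff)
    qed
    moreover have "map (coef l) [0..<N] \<in> {xs. set xs \<subseteq> {..n} \<and> length xs = N}"
      using le by auto
    ultimately show "l \<in> (\<lambda>xs. Poly_Mapping.nth xs) ` {xs. set xs \<subseteq> {..n} \<and> length xs = N}"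
      by blast
  qed
  then show ?thesis
    by (rule finite_subset) (intro finite_imageI finite_lists_length_eq finite_atMost)
qed

lemma finite_tpartitions: "finite (tpartitions N n)"
  unfolding tpartitions_def using finite_partitions by simp

definition mfact :: "mindex \<Rightarrow> nat" where
  "mfact \<alpha> = (\<Prod>i\<in>Poly_Mapping.keys \<alpha>. fact (coef \<alpha> i))"

definition mpochhammer :: "real \<Rightarrow> mindex \<Rightarrow> real" where
  "mpochhammer t \<alpha> = (\<Prod>i\<in>Poly_Mapping.keys \<alpha>. pochhammer t (coef \<alpha> i))"

text \<open>\<open>sort_desc N \<alpha>\<close> is \<open>\<alpha>\<^sup>+\<close>, the nonincreasing rearrangement.\<close>

definition sort_desc :: "nat \<Rightarrow> mindex \<Rightarrow> mindex" where
  "sort_desc N \<alpha> = Poly_Mapping.nth (rev (sort (map (coef \<alpha>) [0..<N])))"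

definition msym :: "nat \<Rightarrow> mindex \<Rightarrow> rpoly" where
  "msym N \<nu> = (\<Sum>\<alpha> | Poly_Mapping.keys \<alpha> \<subseteq> {..<N} \<and> sort_desc N \<alpha> = \<nu>. xpow \<alpha>)"

text \<open>The sum in the definition of \<^const>\<open>msym\<close> ranges over a finite set.\<close>

lemma finite_rearrangements: "finite {\<alpha>. Poly_Mapping.keys \<alpha> \<subseteq> {..<N} \<and> sort_desc N \<alpha> = \<nu>}"
proof -
  define S where "S = insert 0 (range (coef \<nu>))"
  have "finite (range (coef \<nu>))"
    by (rule finite_subset[of _ "insert 0 (coef \<nu> ` Poly_Mapping.keys \<nu>)"]) (auto simp: in_keys_iff)
  then have fin: "finite S" by (simp add: S_def)
  have "{\<alpha>. Poly_Mapping.keys \<alpha> \<subseteq> {..<N} \<and> sort_desc N \<alpha> = \<nu>}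
      \<subseteq> (\<lambda>xs. Poly_Mapping.nth xs) ` {xs. set xs \<subseteq> S \<and> length xs = N}"
  proof
    fix a assume a: "a \<in> {\<alpha>. Poly_Mapping.keys \<alpha> \<subseteq> {..<N} \<and> sort_desc N \<alpha> = \<nu>}"
    let ?l = "rev (sort (map (coef a) [0..<N]))"
    have "coef a i \<in> S" if "i < N" for i
    proof -
      have "coef a i \<in> set ?l" using that by auto
      then obtain k where k: "k < length ?l" "?l ! k = coef a i"
        by (metis in_set_conv_nth)
      then have "coef (sort_desc N a) k = coef a i"
        by (simp add: sort_desc_def nth.rep_eq nth_default_def)
      moreover have "sort_desc N a = \<nu>" using a by simp
      ultimately show ?thesis unfolding S_def by (metis insertI2 rangeI)
    qed
    then have "map (coef a) [0..<N] \<in> {xs. set xs \<subseteq> S \<and> length xs = N}" by auto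
    moreover have "a = Poly_Mapping.nth (map (coef a) [0..<N])"
    proof (rule poly_mapping_eqI)
      fix k
      show "coef a k = coef (Poly_Mapping.nth (map (coef a) [0..<N])) k"
        using a by (cases "k < N") (auto simp: nth.rep_eq nth_default_def in_keys_iff)
    qed
    ultimately show "a \<in> (\<lambda>xs. Poly_Mapping.nth xs) ` {xs. set xs \<subseteq> S \<and> length xs = N}"
      by blast
  qed
  then show ?thesis
    by (rule finite_subset) (intro finite_imageI finite_lists_length_eq fin)
qed

definition e1 :: "nat \<Rightarrow> rpoly" where
  "e1 N = (\<Sum>i<N. X i)"

definition tmsym :: "nat \<Rightarrow> mindex \<Rightarrow> rpoly" where
  "tmsym N \<nu> = e1 N ^ (coef \<nu> 0 - coef \<nu> 1) * msym N (Poly_Mapping.update 0 (coef \<nu> 1) \<nu>)"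

text \<open>
  \<open>B N \<mu> \<nu>\<close> is the coordinate of \<open>m\<^sub>\<nu>\<close> at the index \<open>\<mu>\<close> with respect to the basis given by
  \<^const>\<open>tmsym\<close>; coordinate functions are normalised to vanish off the index set.
\<close>

definition B :: "nat \<Rightarrow> mindex \<Rightarrow> mindex \<Rightarrow> real" where
  "B N \<mu> \<nu> = (THE b. (\<forall>\<rho>. \<rho> \<notin> partitions N (weight \<nu>) \<longrightarrow> b \<rho> = 0) \<and>
      msym N \<nu> = (\<Sum>\<rho>\<in>partitions N (weight \<nu>). cpoly (b \<rho>) * tmsym N \<rho>)) \<mu>"

definition prec :: "mindex \<Rightarrow> mindex \<Rightarrow> bool" where
  "prec \<mu> \<nu> \<longleftrightarrow> weight \<mu> = weight \<nu> \<and> (\<forall>i\<ge>1. coef \<nu> i \<le> coef \<mu> i)"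

definition h :: "nat \<Rightarrow> real \<Rightarrow> mindex \<Rightarrow> rpoly" where
  "h N \<kappa> \<mu> = cpoly (1 / 2 ^ weight \<mu>) *
     (\<Sum>\<nu> | \<nu> \<in> partitions N (weight \<mu>) \<and> prec \<mu> \<nu>.
        cpoly (B N \<mu> \<nu> / (real (mfact \<nu>) * mpochhammer (\<kappa> + 1/2) \<nu>) / eval_poly (\<lambda>_. 1) (msym N \<nu>))
        * subst_poly (\<lambda>i. (X i)\<^sup>2) (msym N \<nu>))"

section \<open>Dunkl operators and the inner product\<close>

definition pderiv_var :: "nat \<Rightarrow> rpoly \<Rightarrow> rpoly" where
  "pderiv_var i p =
     (\<Sum>\<alpha>\<in>Poly_Mapping.keys p. cpoly (coef p \<alpha> * real (coef \<alpha> i)) * xpow (\<alpha> - Poly_Mapping.single i 1))"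

definition reflect :: "nat \<Rightarrow> rpoly \<Rightarrow> rpoly" where
  "reflect i p = subst_poly (\<lambda>j. if j = i then - X j else X j) p"

definition dunkl :: "real \<Rightarrow> nat \<Rightarrow> rpoly \<Rightarrow> rpoly" where
  "dunkl \<kappa> i f = pderiv_var i f + cpoly \<kappa> * (THE q. X i * q = f - reflect i f)"

text \<open>The quotient \<open>(f(x) - f(x\<sigma>\<^sub>i)) / x\<^sub>i\<close> in the definition of \<^const>\<open>dunkl\<close> is well defined.\<close>

lemma xpow_eq_prod: "xpow \<alpha> = (\<Prod>i\<in>Poly_Mapping.keys \<alpha>. X i ^ coef \<alpha> i)"
proof -
  have *: "X i ^ k = xpow (Poly_Mapping.single i k)" for i k
    by (induction k)
      (simp_all add: X_def xpow_def mult_single flip: single_add)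
  have **: "(\<Prod>i\<in>A. xpow (f i)) = xpow (\<Sum>i\<in>A. f i)" if "finite A" for A :: "nat set" and f
    using that by (induction A rule: finite_induct) (simp_all add: xpow_def mult_single)
  have eq: "\<alpha> = (\<Sum>i\<in>Poly_Mapping.keys \<alpha>. Poly_Mapping.single i (coef \<alpha> i))"
  proof (rule poly_mapping_eqI)
    fix k
    show "coef \<alpha> k = coef (\<Sum>i\<in>Poly_Mapping.keys \<alpha>. Poly_Mapping.single i (coef \<alpha> i)) k"
      by (simp add: lookup_sum lookup_single when_def in_keys_iff)
  qed
  have "(\<Prod>i\<in>Poly_Mapping.keys \<alpha>. X i ^ coef \<alpha> i) =
      xpow (\<Sum>i\<in>Poly_Mapping.keys \<alpha>. Poly_Mapping.single i (coef \<alpha> i))"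
    by (simp add: * **)
  also have "\<dots> = xpow \<alpha>" by (rule arg_cong[OF eq[symmetric]])
  finally show ?thesis by (rule sym)
qed

lemma poly_eq_sum: "p = (\<Sum>\<alpha>\<in>Poly_Mapping.keys p. cpoly (coef p \<alpha>) * xpow \<alpha>)"
proof (rule poly_mapping_eqI)
  fix k
  show "coef p k = coef (\<Sum>\<alpha>\<in>Poly_Mapping.keys p. cpoly (coef p \<alpha>) * xpow \<alpha>) k"
    by (simp add: lookup_sum cpoly_def xpow_def mult_single lookup_single when_def in_keys_iff)
qed

lemma ex1_dunkl_quotient: "\<exists>!q. X i * q = f - reflect i f"
proof (rule ex_ex1I)
  have "X i dvd xpow \<alpha> - (\<Prod>j\<in>Poly_Mapping.keys \<alpha>. (if j = i then - X j else X j) ^ coef \<alpha> j)" for \<alpha>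
  proof (cases "i \<in> Poly_Mapping.keys \<alpha>")
    case True
    then have c: "coef \<alpha> i \<noteq> 0" by (simp add: in_keys_iff)
    have "X i dvd (\<Prod>j\<in>Poly_Mapping.keys \<alpha>. X j ^ coef \<alpha> j)"
      by (rule dvd_prod_eqI[OF finite_keys True refl, THEN dvd_trans[rotated]])
        (use c in \<open>simp add: dvd_power\<close>)
    moreover have "X i dvd (\<Prod>j\<in>Poly_Mapping.keys \<alpha>. (if j = i then - X j else X j) ^ coef \<alpha> j)"
    proof -
      have "X i dvd (if i = i then - X i else X i) ^ coef \<alpha> i"
        using dvd_power[of "coef \<alpha> i" "- X i"] c by (simp del: dvd_power)
      then show ?thesis
        by (rule dvd_trans[OF _ dvd_prodI[OF finite_keys True,
              of "\<lambda>j. (if j = i then - X j else X j) ^ coef \<alpha> j"]])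
    qed
    ultimately show ?thesis by (simp add: xpow_eq_prod)
  next
    case False
    then have "(\<Prod>j\<in>Poly_Mapping.keys \<alpha>. (if j = i then - X j else X j) ^ coef \<alpha> j) = xpow \<alpha>"
      unfolding xpow_eq_prod by (intro prod.cong) auto
    then show ?thesis by simp
  qed
  then have "X i dvd (\<Sum>\<alpha>\<in>Poly_Mapping.keys f. cpoly (coef f \<alpha>) *
      (xpow \<alpha> - (\<Prod>j\<in>Poly_Mapping.keys \<alpha>. (if j = i then - X j else X j) ^ coef \<alpha> j)))"
    by (intro dvd_sum dvd_mult)
  also have "\<dots> = (\<Sum>\<alpha>\<in>Poly_Mapping.keys f. cpoly (coef f \<alpha>) * xpow \<alpha>) - reflect i f"
    by (simp add: reflect_def subst_poly_def right_diff_distrib sum_subtractf)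
  also have "(\<Sum>\<alpha>\<in>Poly_Mapping.keys f. cpoly (coef f \<alpha>) * xpow \<alpha>) = f"
    by (rule poly_eq_sum[symmetric])
  finally show "\<exists>q. X i * q = f - reflect i f" by (metis dvdE)
next
  have nz: "X i \<noteq> 0" unfolding X_def xpow_def
    by (metis lookup_single_eq lookup_zero zero_neq_one)
  show "q = r" if "X i * q = f - reflect i f" "X i * r = f - reflect i f" for q r
    by (rule mult_left_cancel[OF nz, THEN iffD1], rule trans[OF that(1) that(2)[symmetric]])
qed

text \<open>
  \<open>dunkl_power\<close> composes the powers of the operators in the order of their indices; as the
  operators commute, the order is immaterial.
\<close>

definition dunkl_power :: "nat \<Rightarrow> real \<Rightarrow> mindex \<Rightarrow> rpoly \<Rightarrow> rpoly" where
  "dunkl_power N \<kappa> \<alpha> = foldr (\<lambda>i T. (dunkl \<kappa> i ^^ coef \<alpha> i) \<circ> T) [0..<N] id"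

definition dunkl_apply :: "nat \<Rightarrow> real \<Rightarrow> rpoly \<Rightarrow> rpoly \<Rightarrow> rpoly" where
  "dunkl_apply N \<kappa> f g = (\<Sum>\<alpha>\<in>Poly_Mapping.keys f. cpoly (coef f \<alpha>) * dunkl_power N \<kappa> \<alpha> g)"

definition inner_h :: "nat \<Rightarrow> real \<Rightarrow> rpoly \<Rightarrow> rpoly \<Rightarrow> real" where
  "inner_h N \<kappa> f g = eval_poly (\<lambda>_. 0) (dunkl_apply N \<kappa> f g)"

section \<open>Gram determinants\<close>

text \<open>
  The determinant of a Gram matrix indexed by a finite set is that of the matrix for any enumeration
  of the set without repetition; reordering permutes rows and columns simultaneously.
\<close>

definition gram_matrix :: "('a \<Rightarrow> 'a \<Rightarrow> real) \<Rightarrow> 'a list \<Rightarrow> real mat" where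
  "gram_matrix ip fs = mat (length fs) (length fs) (\<lambda>(i, j). ip (fs ! i) (fs ! j))"

definition D :: "nat \<Rightarrow> real \<Rightarrow> nat \<Rightarrow> real" where
  "D N \<kappa> k = (\<Prod>\<nu>\<in>partitions N k.
     inverse (real (mfact \<nu>) * mpochhammer (\<kappa> + 1/2) \<nu> * eval_poly (\<lambda>_. 1) (msym N \<nu>)))"

definition d :: "nat \<Rightarrow> nat \<Rightarrow> nat" where
  "d j N = card (tpartitions N j)"

end

(*
Put y = x^2 and c(nu) = nu! (kappa + 1/2)_nu m_nu(1^N).  The monomial symmetric functions in y are
orthogonal with norms 4^n c(nu), so <h_mu, h_rho> = (B C^-1 B^T)(mu, rho) with C = diag(c), where B
is the inverse of the matrix A expanding tm_mu = tmsym N mu in the m_nu.  A is unitriangular, so det A = 1.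
Let S consist of the partitions with equal first two parts and let T be the complement in degree n;
adding 1 to the first part identifies the partitions of n - 1 with T.  Multiplying out
L = [B_S^T, C A_T] in two ways (A^T L and L^T C^-1 L are both block triangular) gives
det (B_S C^-1 B_S^T) = det (A_T^T C A_T) / det C.

As tm_mu = e1 tm_mu' for mu in T, det (A_T^T C A_T) reduces to the determinant of Delta e1 on
degree n - 1, where Delta is the adjoint of multiplication by e1(y) = |x|^2.  Instead of
decomposing into harmonic polynomials, use [Delta, e1] = N (kappa + 1/2) + 2 j =: s_j in degree j
and Sylvester's identity:  det_j (Delta e1 + t) = det_j (e1 Delta + s_j + t)
= (s_j + t)^(d(j, N)) det_(j-1) (Delta e1 + s_j + t), which is iterated down to degree 0.
*)

theory Submission
  imports Defs
begin

text \<open>The step through L is Jacobi's complementary minor identity: B C^-1 B^T and A^T C A are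
  inverse to each other, so a principal minor of one is, up to a full determinant, the complementary
  minor of the other. The two kinds of columns of L are chosen because they are dual: B A = 1 makes
  the columns B_S^T orthogonal to the columns C A_T with respect to C^-1.

  The factors of the product are accumulated shifts: s_(n-1) + ... + s_(n-i) = i (2n - i - 1 + N/2 +
  N kappa). The exponents are the differences of dimensions of consecutive degrees, which
  Sylvester's identity leaves as a power of the shift.

  The operators are handled as explicit sums on coefficient functions over all multi-indices in N
  variables, where the commutator can be checked entry by entry; symmetry enters only when they are
  turned into matrices on partitions. Two cancellations have to be justified, of powers of the shift
  and of the complementary minor; both quantities are positive because kappa >= 0.\<close>

section \<open>Matrices indexed by lists\<close>

text \<open>Entries are addressed by labels instead of positions, so products become sums over label
  sets and blocks correspond to appended lists. Rectangular shapes are allowed since the operators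
  between two degrees need not have square matrices.\<close>

definition lmat :: "'a list \<Rightarrow> 'b list \<Rightarrow> ('a \<Rightarrow> 'b \<Rightarrow> 'c) \<Rightarrow> 'c mat" where
  "lmat ps qs f = mat (length ps) (length qs) (\<lambda>(i, j). f (ps ! i) (qs ! j))"

lemma lmat_carrier [simp]: "lmat ps qs f \<in> carrier_mat (length ps) (length qs)"
  and dim_row_lmat [simp]: "dim_row (lmat ps qs f) = length ps"
  and dim_col_lmat [simp]: "dim_col (lmat ps qs f) = length qs"
  and index_lmat [simp]: "i < length ps \<Longrightarrow> j < length qs \<Longrightarrow> lmat ps qs f $$ (i, j) = f (ps ! i) (qs ! j)"
  by (simp_all add: lmat_def)

lemma lmat_cong:
  "(\<And>a b. a \<in> set ps \<Longrightarrow> b \<in> set qs \<Longrightarrow> f a b = g a b) \<Longrightarrow> lmat ps qs f = lmat ps qs g"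
  by (intro eq_matI) auto

lemma transpose_lmat: "transpose_mat (lmat ps qs f) = lmat qs ps (\<lambda>a b. f b a)"
  by (intro eq_matI) auto

lemma sum_nth_distinct:
  assumes "distinct xs"
  shows "(\<Sum>i = 0..<length xs. g (xs ! i)) = sum g (set xs)"
proof -
  have "bij_betw ((!) xs) {0..<length xs} (set xs)"
    using assms by (intro bij_betw_nth) auto
  then show ?thesis by (rule sum.reindex_bij_betw)
qed

lemma lmat_mult:
  assumes "distinct qs"
  shows "lmat ps qs f * lmat qs rs g = lmat ps rs (\<lambda>a c. \<Sum>b\<in>set qs. f a b * g b c)"
proof (rule eq_matI)
  fix i j
  assume "i < dim_row (lmat ps rs (\<lambda>a c. \<Sum>b\<in>set qs. f a b * g b c))"
    and "j < dim_col (lmat ps rs (\<lambda>a c. \<Sum>b\<in>set qs. f a b * g b c))"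
  then show "(lmat ps qs f * lmat qs rs g) $$ (i, j) =
      lmat ps rs (\<lambda>a c. \<Sum>b\<in>set qs. f a b * g b c) $$ (i, j)"
    by (simp add: scalar_prod_def sum_nth_distinct[OF assms, symmetric])
qed simp_all

lemma sum_delta_mult_left:
  fixes g :: "'a \<Rightarrow> 'c :: semiring_1"
  assumes "finite S"
  shows "(\<Sum>b\<in>S. (if a = b then 1 else 0) * g b) = (if a \<in> S then g a else 0)"
proof -
  have "(\<Sum>b\<in>S. (if a = b then 1 else 0) * g b) = (\<Sum>b\<in>S. if a = b then g b else 0)"
    by (intro sum.cong) auto
  then show ?thesis using assms by simp
qed

lemma sum_delta_mult_right:
  fixes g :: "'a \<Rightarrow> 'c :: semiring_1"
  assumes "finite S"
  shows "(\<Sum>b\<in>S. g b * (if b = a then 1 else 0)) = (if a \<in> S then g a else 0)"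
proof -
  have "(\<Sum>b\<in>S. g b * (if b = a then 1 else 0)) = (\<Sum>b\<in>S. if b = a then g b else 0)"
    by (intro sum.cong) auto
  then show ?thesis using assms by simp
qed

lemma lmat_one: "distinct ps \<Longrightarrow> lmat ps ps (\<lambda>a b. if a = b then 1 else 0) = 1\<^sub>m (length ps)"
  by (rule eq_matI) (auto simp: nth_eq_iff_index_eq)

lemma det_lmat_transpose: "det (lmat ps ps (\<lambda>a b. f b a)) = det (lmat ps ps f)"
  using det_transpose[OF lmat_carrier[of ps ps f]] unfolding transpose_lmat .

lemma det_lmat_mult:
  fixes f g :: "'a \<Rightarrow> 'a \<Rightarrow> 'c :: comm_ring_1"
  assumes "distinct ps"
  shows "det (lmat ps ps (\<lambda>a c. \<Sum>b\<in>set ps. f a b * g b c)) = det (lmat ps ps f) * det (lmat ps ps g)"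
  using det_mult[OF lmat_carrier[of ps ps f] lmat_carrier[of ps ps g]] unfolding lmat_mult[OF assms] .

text \<open>The two 0/1 matrices between the enumerations are mutually inverse permutation matrices.
  Conjugating by them changes the enumeration, and their determinants cancel without any sign being
  computed.\<close>

lemma det_lmat_reorder:
  fixes f :: "'a \<Rightarrow> 'a \<Rightarrow> 'c :: idom"
  assumes ps: "distinct ps" and qs: "distinct qs" and eq: "set ps = set qs"
  shows "det (lmat ps ps f) = det (lmat qs qs f)"
proof -
  let ?e = "\<lambda>a b. if a = b then 1 else 0 :: 'c"
  have len: "length ps = length qs"
    using distinct_card[OF ps] distinct_card[OF qs] eq by simp
  have P: "lmat ps qs ?e \<in> carrier_mat (length qs) (length qs)"
    and Q: "lmat qs ps ?e \<in> carrier_mat (length qs) (length qs)"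
    using lmat_carrier[of ps qs ?e] lmat_carrier[of qs ps ?e] len by simp_all
  have F: "lmat qs qs f \<in> carrier_mat (length qs) (length qs)" by simp
  have "lmat ps qs ?e * lmat qs ps ?e = lmat ps ps ?e"
    unfolding lmat_mult[OF qs] by (rule lmat_cong) (simp add: sum_delta_mult_left eq)
  then have one: "det (lmat ps qs ?e) * det (lmat qs ps ?e) = 1"
    using det_mult[OF P Q] by (simp add: lmat_one[OF ps])
  have "lmat ps qs ?e * lmat qs qs f * lmat qs ps ?e = lmat ps ps f"
    unfolding lmat_mult[OF qs]
    by (rule lmat_cong) (simp only: sum_delta_mult_left sum_delta_mult_right finite_set eq if_True)
  then have "det (lmat ps ps f) = det (lmat ps qs ?e) * det (lmat qs qs f) * det (lmat qs ps ?e)"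
    using det_mult[OF mult_carrier_mat[OF P F] Q] det_mult[OF P F] by simp
  then show ?thesis using one by (simp add: mult_ac)
qed

lemma det_lmat_diag:
  fixes c :: "'a \<Rightarrow> 'c :: comm_ring_1"
  assumes "distinct ps"
  shows "det (lmat ps ps (\<lambda>a b. if a = b then c a else 0)) = prod c (set ps)"
proof -
  have "upper_triangular (lmat ps ps (\<lambda>a b. if a = b then c a else 0))"
    using assms by (auto simp: upper_triangular_def nth_eq_iff_index_eq)
  from det_upper_triangular[OF this lmat_carrier]
  have "det (lmat ps ps (\<lambda>a b. if a = b then c a else 0)) =
      prod_list (diag_mat (lmat ps ps (\<lambda>a b. if a = b then c a else 0)))" .
  also have "diag_mat (lmat ps ps (\<lambda>a b. if a = b then c a else 0)) = map c ps"
    by (rule nth_equalityI) (auto simp: diag_mat_def)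
  finally show ?thesis using assms by (simp add: prod.distinct_set_conv_list)
qed

lemma lmat_add: "lmat ps qs f + lmat ps qs g = lmat ps qs (\<lambda>a b. f a b + g a b)"
  by (rule eq_matI) auto

lemma smult_one_lmat:
  fixes t :: "'c :: semiring_1"
  assumes "distinct ps"
  shows "t \<cdot>\<^sub>m 1\<^sub>m (length ps) = lmat ps ps (\<lambda>a b. if a = b then t else 0)"
  using assms by (intro eq_matI) (auto simp: nth_eq_iff_index_eq)

lemma lmat_map: "lmat (map k ps) (map l qs) f = lmat ps qs (\<lambda>a b. f (k a) (l b))"
  by (rule eq_matI) auto

lemma det_lmat_scale_rows:
  fixes f :: "'a \<Rightarrow> 'a \<Rightarrow> 'c :: comm_ring_1"
  assumes "distinct ps"
  shows "det (lmat ps ps (\<lambda>a b. c a * f a b)) = prod c (set ps) * det (lmat ps ps f)"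
proof -
  have "lmat ps ps (\<lambda>a b. c a * f a b) =
      lmat ps ps (\<lambda>a b. \<Sum>x\<in>set ps. (if a = x then c a else 0) * f x b)"
  proof (rule lmat_cong)
    fix a b assume "a \<in> set ps"
    then have "(\<Sum>x\<in>set ps. if a = x then c a * f x b else 0) = c a * f a b" by simp
    then show "c a * f a b = (\<Sum>x\<in>set ps. (if a = x then c a else 0) * f x b)"
      by (simp add: if_distrib[of "\<lambda>y. y * _"] cong: if_cong)
  qed
  then show ?thesis by (simp only: det_lmat_mult[OF assms] det_lmat_diag[OF assms])
qed

text \<open>Sorting the labels by the rank \<open>r\<close> moves every nonzero off-diagonal entry
  above the diagonal. Ties in the sorting are harmless because distinct labels of equal rank have
  entry 0.\<close>

lemma det_lmat_unitriangular:
  fixes f :: "'a \<Rightarrow> 'a \<Rightarrow> 'c :: idom" and r :: "'a \<Rightarrow> nat"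
  assumes ps: "distinct ps"
    and diag: "\<And>a. a \<in> set ps \<Longrightarrow> f a a = 1"
    and tri: "\<And>a b. a \<in> set ps \<Longrightarrow> b \<in> set ps \<Longrightarrow> f a b \<noteq> 0 \<Longrightarrow> a \<noteq> b \<Longrightarrow> r a < r b"
  shows "det (lmat ps ps f) = 1"
proof -
  define qs where "qs = sort_key r ps"
  have qs: "distinct qs" "set qs = set ps" by (simp_all add: qs_def ps)
  have srt: "sorted (map r qs)" by (simp add: qs_def)
  have "upper_triangular (lmat qs qs f)"
  proof (unfold upper_triangular_def, intro allI impI)
    fix i j assume ij: "i < dim_row (lmat qs qs f)" "j < i"
    then have "r (qs ! j) \<le> r (qs ! i)"
      using sorted_nth_mono[OF srt, of j i] by simp
    moreover have "qs ! i \<noteq> qs ! j" using ij qs(1) by (simp add: nth_eq_iff_index_eq)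
    ultimately have "f (qs ! i) (qs ! j) = 0"
      using tri[of "qs ! i" "qs ! j"] ij qs(2) by (metis dim_row_lmat leD nth_mem order.strict_trans)
    then show "lmat qs qs f $$ (i, j) = 0" using ij by simp
  qed
  from det_upper_triangular[OF this lmat_carrier]
  have "det (lmat qs qs f) = prod_list (diag_mat (lmat qs qs f))" .
  also have "diag_mat (lmat qs qs f) = map (\<lambda>_. 1) qs"
    by (rule nth_equalityI) (auto simp: diag_mat_def diag qs(2)[symmetric])
  also have "prod_list (map (\<lambda>_. 1 :: 'c) qs) = 1" by (simp add: map_replicate_const)
  finally show ?thesis using det_lmat_reorder[OF qs(1) ps qs(2), of f] by simp
qed

lemma lmat_append:
  "lmat (ps @ rs) (qs @ ss) f =
    four_block_mat (lmat ps qs f) (lmat ps ss f) (lmat rs qs f) (lmat rs ss f)"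
  by (rule eq_matI) (auto simp: nth_append)

lemma det_lmat_block_triangular:
  fixes f :: "'a \<Rightarrow> 'a \<Rightarrow> 'c :: idom"
  assumes "\<And>a b. a \<in> set rs \<Longrightarrow> b \<in> set ps \<Longrightarrow> f a b = 0"
  shows "det (lmat (ps @ rs) (ps @ rs) f) = det (lmat ps ps f) * det (lmat rs rs f)"
proof -
  have "lmat rs ps f = 0\<^sub>m (length rs) (length ps)"
    using assms by (intro eq_matI) auto
  from det_four_block_mat_lower_left_zero[OF lmat_carrier lmat_carrier this lmat_carrier]
  show ?thesis by (simp add: lmat_append)
qed

text \<open>One block matrix \<open>?M\<close> is eliminated in two ways: clearing its lower left
  block by column operations leaves \<open>U * V\<close>, by row operations \<open>V * U\<close>.
  Powers of \<open>t\<close> stay on both sides so that nothing has to be divided.\<close>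

lemma det_sylvester:
  fixes U V :: "'c :: idom mat"
  assumes U: "U \<in> carrier_mat p q" and V: "V \<in> carrier_mat q p"
  shows "t ^ q * det (t \<cdot>\<^sub>m 1\<^sub>m p + U * V) = t ^ p * det (t \<cdot>\<^sub>m 1\<^sub>m q + V * U)"
proof -
  let ?M = "four_block_mat (t \<cdot>\<^sub>m 1\<^sub>m p) (- U) V (1\<^sub>m q)"
  let ?L = "four_block_mat (1\<^sub>m p) (0\<^sub>m p q) (- V) (t \<cdot>\<^sub>m 1\<^sub>m q)"
  let ?R = "four_block_mat (1\<^sub>m p) (0\<^sub>m p q) (- V) (1\<^sub>m q)"
  have M: "?M \<in> carrier_mat (p + q) (p + q)" and L: "?L \<in> carrier_mat (p + q) (p + q)"
    and R: "?R \<in> carrier_mat (p + q) (p + q)"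
    using U V by (auto intro!: four_block_carrier_mat)
  have "?M * ?R = four_block_mat (t \<cdot>\<^sub>m 1\<^sub>m p + U * V) (- U) (0\<^sub>m q p) (1\<^sub>m q)"
    using U V by (subst mult_four_block_mat[of _ p p _ q _ q _ _ p _ q]) auto
  moreover have "det ?R = 1"
    using V by (subst det_four_block_mat_upper_right_zero) auto
  moreover have "det (four_block_mat (t \<cdot>\<^sub>m 1\<^sub>m p + U * V) (- U) (0\<^sub>m q p) (1\<^sub>m q))
      = det (t \<cdot>\<^sub>m 1\<^sub>m p + U * V)"
    using U V by (subst det_four_block_mat_lower_left_zero) auto
  ultimately have 1: "det ?M = det (t \<cdot>\<^sub>m 1\<^sub>m p + U * V)"
    using det_mult[OF M R] by simp
  have "?L * ?M = four_block_mat (t \<cdot>\<^sub>m 1\<^sub>m p) (- U) (0\<^sub>m q p) (t \<cdot>\<^sub>m 1\<^sub>m q + V * U)"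
    using U V by (subst mult_four_block_mat[of _ p p _ q _ q _ _ p _ q]) (auto simp: comm_add_mat)
  moreover have "det ?L = t ^ q"
    using V by (subst det_four_block_mat_upper_right_zero) (auto simp: det_smult)
  moreover have "det (four_block_mat (t \<cdot>\<^sub>m 1\<^sub>m p) (- U) (0\<^sub>m q p) (t \<cdot>\<^sub>m 1\<^sub>m q + V * U))
      = t ^ p * det (t \<cdot>\<^sub>m 1\<^sub>m q + V * U)"
    using U V by (subst det_four_block_mat_lower_left_zero) (auto simp: det_smult)
  ultimately show ?thesis using det_mult[OF L M] 1 by simp
qed

section \<open>Multi-indices\<close>

definition mindices :: "nat \<Rightarrow> mindex set" where
  "mindices N = {\<alpha>. Poly_Mapping.keys \<alpha> \<subseteq> {..<N}}"

lemma coef_mindices_eq_0: "\<alpha> \<in> mindices N \<Longrightarrow> N \<le> i \<Longrightarrow> coef \<alpha> i = 0"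
  by (force simp: mindices_def in_keys_iff)

lemma mindicesI:
  assumes "\<And>i. N \<le> i \<Longrightarrow> coef \<alpha> i = 0"
  shows "\<alpha> \<in> mindices N"
proof -
  have "i < N" if "coef \<alpha> i \<noteq> 0" for i using assms[of i] that by (cases "N \<le> i") auto
  then show ?thesis by (auto simp: mindices_def in_keys_iff)
qed

lemma mindices_eqI:
  "\<alpha> \<in> mindices N \<Longrightarrow> \<beta> \<in> mindices N \<Longrightarrow> (\<And>i. i < N \<Longrightarrow> coef \<alpha> i = coef \<beta> i) \<Longrightarrow> \<alpha> = \<beta>"
  by (rule poly_mapping_eqI) (metis coef_mindices_eq_0 linorder_not_le)

definition inc :: "nat \<Rightarrow> mindex \<Rightarrow> mindex" where
  "inc i \<alpha> = Poly_Mapping.update i (Suc (coef \<alpha> i)) \<alpha>"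

text \<open>Division of a monomial by a variable. Truncated subtraction leaves the index unchanged
  at a zero entry, which is why \<open>raising\<close> guards that case explicitly.\<close>

definition dec :: "nat \<Rightarrow> mindex \<Rightarrow> mindex" where
  "dec i \<alpha> = Poly_Mapping.update i (coef \<alpha> i - 1) \<alpha>"

lemma coef_inc: "coef (inc i \<alpha>) j = (if i = j then Suc (coef \<alpha> i) else coef \<alpha> j)"
  by (simp add: inc_def lookup_update)

lemma coef_dec: "coef (dec i \<alpha>) j = (if i = j then coef \<alpha> i - 1 else coef \<alpha> j)"
  by (simp add: dec_def lookup_update)

lemma dec_inc [simp]: "dec i (inc i \<alpha>) = \<alpha>"
  by (rule poly_mapping_eqI) (simp add: coef_inc coef_dec)

lemma inc_dec [simp]: "coef \<alpha> i \<noteq> 0 \<Longrightarrow> inc i (dec i \<alpha>) = \<alpha>"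
  by (rule poly_mapping_eqI) (auto simp: coef_inc coef_dec)

lemma dec_inc_commute: "i \<noteq> j \<Longrightarrow> dec j (inc i \<alpha>) = inc i (dec j \<alpha>)"
  by (rule poly_mapping_eqI) (auto simp: coef_inc coef_dec)

lemma inc_eq_add: "inc i \<alpha> = Poly_Mapping.single i 1 + \<alpha>"
  by (rule poly_mapping_eqI) (auto simp: coef_inc lookup_add lookup_single when_def)

lemma inc_mindices [simp]: "i < N \<Longrightarrow> \<alpha> \<in> mindices N \<Longrightarrow> inc i \<alpha> \<in> mindices N"
  by (intro mindicesI) (auto simp: coef_inc coef_mindices_eq_0)

lemma dec_mindices [simp]: "\<alpha> \<in> mindices N \<Longrightarrow> dec i \<alpha> \<in> mindices N"
  by (intro mindicesI) (auto simp: coef_dec coef_mindices_eq_0)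

lemma dec_mindices_iff: "i < N \<Longrightarrow> dec i \<alpha> \<in> mindices N \<longleftrightarrow> \<alpha> \<in> mindices N"
proof
  assume i: "i < N" and *: "dec i \<alpha> \<in> mindices N"
  show "\<alpha> \<in> mindices N"
  proof (rule mindicesI)
    fix j assume "N \<le> j"
    then show "coef \<alpha> j = 0" using coef_mindices_eq_0[OF *, of j] i by (auto simp: coef_dec)
  qed
qed simp

lemma weight_eq_sum: "\<alpha> \<in> mindices N \<Longrightarrow> weight \<alpha> = (\<Sum>i<N. coef \<alpha> i)"
  unfolding weight_def mindices_def
  by (intro sum.mono_neutral_left) (auto simp: in_keys_iff)

lemma weight_inc:
  assumes "i < N" "\<alpha> \<in> mindices N"
  shows "weight (inc i \<alpha>) = Suc (weight \<alpha>)"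
proof -
  have "(\<Sum>j<N. coef (inc i \<alpha>) j) = (\<Sum>j<N. coef \<alpha> j + (if j = i then 1 else 0))"
    by (intro sum.cong) (auto simp: coef_inc)
  also have "\<dots> = Suc (\<Sum>j<N. coef \<alpha> j)" using assms(1) by (simp add: sum.distrib)
  finally show ?thesis using assms by (simp add: weight_eq_sum[of _ N])
qed

lemma weight_dec:
  assumes "i < N" "\<alpha> \<in> mindices N" "coef \<alpha> i \<noteq> 0"
  shows "Suc (weight (dec i \<alpha>)) = weight \<alpha>"
  using weight_inc[of i N "dec i \<alpha>"] assms by simp

section \<open>Rearrangements\<close>

lemma map_sort_desc: "map (coef (sort_desc N \<alpha>)) [0..<N] = rev (sort (map (coef \<alpha>) [0..<N]))"
  by (rule nth_equalityI) (auto simp: sort_desc_def nth_default_def)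

lemma sort_desc_mindices [simp]: "sort_desc N \<alpha> \<in> mindices N"
  by (intro mindicesI) (simp add: sort_desc_def nth_default_def)

lemma antimono_sort_desc: "antimono (coef (sort_desc N \<alpha>))"
proof (rule antimonoI)
  fix i j :: nat assume ij: "i \<le> j"
  show "coef (sort_desc N \<alpha>) j \<le> coef (sort_desc N \<alpha>) i"
  proof (cases "j < N")
    case True
    have "sorted (sort (map (coef \<alpha>) [0..<N]))" by simp
    then have "rev (sort (map (coef \<alpha>) [0..<N])) ! j \<le> rev (sort (map (coef \<alpha>) [0..<N])) ! i"
      using ij True by (intro sorted_rev_nth_mono) auto
    then show ?thesis using ij True by (simp add: sort_desc_def nth_default_def)
  qed (simp add: coef_mindices_eq_0[OF sort_desc_mindices])
qed

text \<open>Equality of the multisets of entries yields the permutation. Sums and products over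
  positions are later transferred to the sorted index by reindexing along \<open>p\<close>.\<close>

lemma sort_desc_permutation:
  obtains p where "p permutes {..<N}" "\<And>i. i < N \<Longrightarrow> coef \<alpha> i = coef (sort_desc N \<alpha>) (p i)"
proof -
  have "mset (map (coef \<alpha>) [0..<N]) = mset (map (coef (sort_desc N \<alpha>)) [0..<N])"
    unfolding map_sort_desc by simp
  then obtain p where p: "p permutes {..<N}"
    and eq: "permute_list p (map (coef (sort_desc N \<alpha>)) [0..<N]) = map (coef \<alpha>) [0..<N]"
    using mset_eq_permutation[of "map (coef \<alpha>) [0..<N]" "map (coef (sort_desc N \<alpha>)) [0..<N]"]
    by (metis diff_zero length_map length_upt)
  have "coef \<alpha> i = coef (sort_desc N \<alpha>) (p i)" if "i < N" for i
  proof -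
    have "p i < N" using p that by (metis permutes_in_image lessThan_iff)
    have "coef \<alpha> i = permute_list p (map (coef (sort_desc N \<alpha>)) [0..<N]) ! i"
      using that by (simp add: eq)
    also have "\<dots> = coef (sort_desc N \<alpha>) (p i)"
      using that p \<open>p i < N\<close> by (subst permute_list_nth) auto
    finally show ?thesis .
  qed
  with p show ?thesis by (rule that)
qed

lemma sort_desc_permute:
  assumes p: "p permutes {..<N}" and eq: "\<And>i. i < N \<Longrightarrow> coef \<beta> i = coef \<alpha> (p i)"
  shows "sort_desc N \<beta> = sort_desc N \<alpha>"
proof -
  have lt: "p i < N" if "i < N" for i using p that by (metis permutes_in_image lessThan_iff)
  have "map (coef \<beta>) [0..<N] = permute_list p (map (coef \<alpha>) [0..<N])"
    using p lt by (intro nth_equalityI) (auto simp: permute_list_nth eq)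
  then have "mset (map (coef \<beta>) [0..<N]) = mset (map (coef \<alpha>) [0..<N])"
    using p by simp
  then have "sort (map (coef \<beta>) [0..<N]) = sort (map (coef \<alpha>) [0..<N])"
    by (metis sorted_list_of_multiset_mset)
  then show ?thesis by (simp add: sort_desc_def)
qed

lemma sort_desc_idem:
  assumes "\<nu> \<in> mindices N" "antimono (coef \<nu>)"
  shows "sort_desc N \<nu> = \<nu>"
proof (rule mindices_eqI)
  fix i assume i: "i < N"
  have "sorted (rev (map (coef \<nu>) [0..<N]))"
    using assms(2) by (auto simp: sorted_rev_iff_nth_mono antimono_def)
  then have "sort (map (coef \<nu>) [0..<N]) = rev (map (coef \<nu>) [0..<N])"
    by (intro properties_for_sort) auto
  then have "map (coef (sort_desc N \<nu>)) [0..<N] = map (coef \<nu>) [0..<N]"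
    unfolding map_sort_desc by simp
  then show "coef (sort_desc N \<nu>) i = coef \<nu> i" using i by simp
qed (use assms in auto)

lemma sum_sort_desc: "(\<Sum>i<N. g (coef (sort_desc N \<alpha>) i)) = (\<Sum>i<N. g (coef \<alpha> i))"
proof -
  obtain p where p: "p permutes {..<N}" "\<And>i. i < N \<Longrightarrow> coef \<alpha> i = coef (sort_desc N \<alpha>) (p i)"
    using sort_desc_permutation[of N \<alpha>] by blast
  show ?thesis using sum.permute[OF p(1), of "\<lambda>i. g (coef (sort_desc N \<alpha>) i)"] p(2) by simp
qed

lemma prod_sort_desc: "(\<Prod>i<N. g (coef (sort_desc N \<alpha>) i)) = (\<Prod>i<N. g (coef \<alpha> i))"
proof -
  obtain p where p: "p permutes {..<N}" "\<And>i. i < N \<Longrightarrow> coef \<alpha> i = coef (sort_desc N \<alpha>) (p i)"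
    using sort_desc_permutation[of N \<alpha>] by blast
  show ?thesis using prod.permute[OF p(1), of "\<lambda>i. g (coef (sort_desc N \<alpha>) i)"] p(2) by simp
qed

lemma weight_sort_desc: "\<alpha> \<in> mindices N \<Longrightarrow> weight (sort_desc N \<alpha>) = weight \<alpha>"
  using sum_sort_desc[where g = "\<lambda>x. x"] by (simp add: weight_eq_sum[of _ N])

lemma coef_le_sort_desc_0:
  assumes "i < N"
  shows "coef \<alpha> i \<le> coef (sort_desc N \<alpha>) 0"
proof -
  obtain p where "coef \<alpha> i = coef (sort_desc N \<alpha>) (p i)"
    using assms by (metis sort_desc_permutation)
  then show ?thesis using antimonoD[OF antimono_sort_desc, of 0 "p i"] by simp
qed

text \<open>Pigeonhole: of the k + 1 positions holding the sorted entries 0, ..., k, one is at least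
  k. Its entry is at least the sorted entry k, and it is bounded by \<nu> at that position, hence by
  \<open>coef \<nu> k\<close>.\<close>

lemma sort_desc_le:
  assumes "antimono (coef \<nu>)" and le: "\<And>i. coef \<alpha> i \<le> coef \<nu> i"
  shows "coef (sort_desc N \<alpha>) k \<le> coef \<nu> k"
proof (cases "k < N")
  case True
  obtain p where p: "p permutes {..<N}" "\<And>i. i < N \<Longrightarrow> coef \<alpha> i = coef (sort_desc N \<alpha>) (p i)"
    using sort_desc_permutation[of N \<alpha>] by blast
  let ?q = "Hilbert_Choice.inv p"
  have inj: "inj ?q" using permutes_inj[OF permutes_inv[OF p(1)]] .
  have "\<not> ?q ` {..k} \<subseteq> {..<k}"
  proof
    assume "?q ` {..k} \<subseteq> {..<k}"
    then have "card (?q ` {..k}) \<le> card {..<k}" by (intro card_mono) auto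
    moreover have "card (?q ` {..k}) = Suc k"
      using inj by (simp add: card_image inj_on_subset[OF inj])
    ultimately show False by simp
  qed
  then obtain j where j: "j \<le> k" "k \<le> ?q j" by force
  have "?q j < N"
    using j True permutes_in_image[OF permutes_inv[OF p(1)], of j] by simp
  have "coef (sort_desc N \<alpha>) k \<le> coef (sort_desc N \<alpha>) j"
    by (rule antimonoD[OF antimono_sort_desc j(1)])
  also have "\<dots> = coef \<alpha> (?q j)"
    using p(2)[OF \<open>?q j < N\<close>] by (simp add: permutes_inverses(1)[OF p(1)])
  also have "\<dots> \<le> coef \<nu> (?q j)" by (rule le)
  also have "\<dots> \<le> coef \<nu> k" by (rule antimonoD[OF assms(1) j(2)])
  finally show ?thesis .
qed (simp add: coef_mindices_eq_0[OF sort_desc_mindices])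

lemma partitions_iff: "\<nu> \<in> partitions N n \<longleftrightarrow> \<nu> \<in> mindices N \<and> antimono (coef \<nu>) \<and> weight \<nu> = n"
  by (auto simp: partitions_def mindices_def)

lemma sort_desc_partitions:
  "\<alpha> \<in> mindices N \<Longrightarrow> weight \<alpha> = n \<Longrightarrow> sort_desc N \<alpha> \<in> partitions N n"
  by (simp add: partitions_iff antimono_sort_desc weight_sort_desc)

lemma sort_desc_partition [simp]: "\<nu> \<in> partitions N n \<Longrightarrow> sort_desc N \<nu> = \<nu>"
  by (simp add: partitions_iff sort_desc_idem)

lemma inc_0_partitions:
  assumes "N \<ge> 1" "\<nu> \<in> partitions N n"
  shows "inc 0 \<nu> \<in> partitions N (Suc n)" and "inc 0 \<nu> \<notin> tpartitions N (Suc n)"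
proof -
  have *: "coef \<nu> j \<le> coef \<nu> i" if "i \<le> j" for i j
    using assms(2) that by (auto simp: partitions_iff dest: antimonoD)
  have "antimono (coef (inc 0 \<nu>))"
    by (rule antimonoI) (auto simp: coef_inc * le_SucI)
  then show "inc 0 \<nu> \<in> partitions N (Suc n)"
    using assms weight_inc[of 0 N \<nu>] by (simp add: partitions_iff)
  show "inc 0 \<nu> \<notin> tpartitions N (Suc n)"
    using *[of 0 1] by (auto simp: tpartitions_def coef_inc)
qed

lemma dec_0_partitions:
  assumes "N \<ge> 1" "\<nu> \<in> partitions N (Suc n)" "\<nu> \<notin> tpartitions N (Suc n)"
  shows "dec 0 \<nu> \<in> partitions N n" and "inc 0 (dec 0 \<nu>) = \<nu>"
proof -
  have *: "coef \<nu> j \<le> coef \<nu> i" if "i \<le> j" for i j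
    using assms(2) that by (auto simp: partitions_iff dest: antimonoD)
  have gt: "coef \<nu> 1 < coef \<nu> 0" using assms(2,3) *[of 0 1] by (auto simp: tpartitions_def)
  have "coef \<nu> j \<le> coef \<nu> 0 - 1" if "j > 0" for j
    using *[of 1 j] gt that by linarith
  then have "antimono (coef (dec 0 \<nu>))"
    by (intro antimonoI) (auto simp: coef_dec *)
  then show "dec 0 \<nu> \<in> partitions N n"
    using assms weight_dec[of 0 N \<nu>] gt by (simp add: partitions_iff)
  show "inc 0 (dec 0 \<nu>) = \<nu>" using gt by simp
qed

lemma partitions_Suc:
  assumes "N \<ge> 1"
  shows "partitions N (Suc n) = tpartitions N (Suc n) \<union> inc 0 ` partitions N n"
    and "tpartitions N (Suc n) \<inter> inc 0 ` partitions N n = {}"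
proof -
  have "\<nu> \<in> inc 0 ` partitions N n" if "\<nu> \<in> partitions N (Suc n)" "\<nu> \<notin> tpartitions N (Suc n)" for \<nu>
    using dec_0_partitions[OF assms that] by (metis image_eqI)
  moreover have "tpartitions N (Suc n) \<subseteq> partitions N (Suc n)" by (auto simp: tpartitions_def)
  ultimately show "partitions N (Suc n) = tpartitions N (Suc n) \<union> inc 0 ` partitions N n"
    using inc_0_partitions(1)[OF assms] by blast
  show "tpartitions N (Suc n) \<inter> inc 0 ` partitions N n = {}"
    using inc_0_partitions(2)[OF assms] by blast
qed

lemma inj_inc: "inj_on (inc i) A"
  by (rule inj_on_inverseI[of _ "dec i"]) simp

lemma partitions_0: "partitions N 0 = {0}"
proof -
  have "\<nu> = 0" if "\<nu> \<in> partitions N 0" for \<nu>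
  proof (rule mindices_eqI)
    show "\<nu> \<in> mindices N" "0 \<in> mindices N" using that by (auto simp: partitions_iff mindices_def)
    show "coef \<nu> i = coef 0 i" if "i < N" for i
      using \<open>\<nu> \<in> partitions N 0\<close> that by (auto simp: partitions_iff weight_eq_sum)
  qed
  moreover have "0 \<in> partitions N 0"
    by (auto simp: partitions_def weight_def antimono_def)
  ultimately show ?thesis by blast
qed

text \<open>This is where the exponents \<open>d\<close> come from: they are the differences of the
  dimensions of consecutive degrees.\<close>

lemma card_partitions_Suc:
  "N \<ge> 1 \<Longrightarrow> card (partitions N (Suc n)) = d (Suc n) N + card (partitions N n)"
  by (simp add: partitions_Suc card_Un_disjoint finite_tpartitions finite_partitions
      card_image inj_inc d_def)

lemma d_0: "d 0 N = 1"
proof -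
  have "tpartitions N 0 = {0}" using partitions_0[of N] by (auto simp: tpartitions_def)
  then show ?thesis by (simp add: d_def)
qed

section \<open>Raising and lowering operators\<close>

text \<open>
  Polynomials in \<open>y = x\<^sup>2\<close> are represented by their coefficient functions: \<open>raising\<close> is
  multiplication by \<open>e\<^sub>1(y) = \<bar>x\<bar>\<^sup>2\<close>, and \<open>lowering\<close> is a quarter of the Dunkl Laplacian
  \<open>\<Sum>\<^sub>i \<D>\<^sub>i\<^sup>2\<close>.
\<close>

definition raising :: "nat \<Rightarrow> (mindex \<Rightarrow> real) \<Rightarrow> mindex \<Rightarrow> real" where
  "raising N f \<alpha> = (\<Sum>i<N. if coef \<alpha> i = 0 then 0 else f (dec i \<alpha>))"

definition lowering :: "nat \<Rightarrow> real \<Rightarrow> (mindex \<Rightarrow> real) \<Rightarrow> mindex \<Rightarrow> real" where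
  "lowering N \<kappa> f \<alpha> =
    (\<Sum>i<N. (real (coef \<alpha> i) + 1) * (\<kappa> + 1/2 + real (coef \<alpha> i)) * f (inc i \<alpha>))"

text \<open>Changes at distinct positions commute, so only equal positions contribute. With a =
  \<open>coef \<alpha> i\<close> and k = \<kappa> + 1/2 they leave (a + 1)(k + a) - a(k + a - 1) = k
  + 2a, and summing over i gives the scalar.\<close>

lemma lowering_raising:
  assumes "\<alpha> \<in> mindices N"
  shows "lowering N \<kappa> (raising N f) \<alpha> =
    raising N (lowering N \<kappa> f) \<alpha> + (real N * (\<kappa> + 1/2) + 2 * real (weight \<alpha>)) * f \<alpha>"
proof -
  let ?w = "\<lambda>a :: nat. (real a + 1) * (\<kappa> + 1/2 + real a)"
  have "lowering N \<kappa> (raising N f) \<alpha> =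
      (\<Sum>i<N. \<Sum>j<N. ?w (coef \<alpha> i) * (if coef (inc i \<alpha>) j = 0 then 0 else f (dec j (inc i \<alpha>))))"
    by (simp add: lowering_def raising_def sum_distrib_left)
  also have "\<dots> = (\<Sum>i<N. \<Sum>j<N. (if coef \<alpha> j = 0 then 0 else ?w (coef (dec j \<alpha>) i) * f (inc i (dec j \<alpha>)))
      + (if j = i then (\<kappa> + 1/2 + 2 * real (coef \<alpha> i)) * f \<alpha> else 0))"
  proof (intro sum.cong refl)
    fix i j
    show "?w (coef \<alpha> i) * (if coef (inc i \<alpha>) j = 0 then 0 else f (dec j (inc i \<alpha>))) =
      (if coef \<alpha> j = 0 then 0 else ?w (coef (dec j \<alpha>) i) * f (inc i (dec j \<alpha>)))
      + (if j = i then (\<kappa> + 1/2 + 2 * real (coef \<alpha> i)) * f \<alpha> else 0)"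
    proof (cases "i = j")
      case True
      show ?thesis
      proof (cases "coef \<alpha> j")
        case 0
        then show ?thesis using True by (simp add: coef_inc)
      next
        case (Suc m)
        then show ?thesis using True by (simp add: coef_inc coef_dec algebra_simps)
      qed
    qed (simp add: coef_inc coef_dec dec_inc_commute)
  qed
  also have "\<dots> = (\<Sum>j<N. \<Sum>i<N. if coef \<alpha> j = 0 then 0 else ?w (coef (dec j \<alpha>) i) * f (inc i (dec j \<alpha>)))
      + (\<Sum>i<N. (\<kappa> + 1/2 + 2 * real (coef \<alpha> i)) * f \<alpha>)"
    by (simp add: sum.distrib) (rule sum.swap)
  also have "(\<Sum>j<N. \<Sum>i<N. if coef \<alpha> j = 0 then 0 else ?w (coef (dec j \<alpha>) i) * f (inc i (dec j \<alpha>)))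
      = raising N (lowering N \<kappa> f) \<alpha>"
    unfolding raising_def lowering_def by (intro sum.cong) auto
  also have "(\<Sum>i<N. (\<kappa> + 1/2 + 2 * real (coef \<alpha> i)) * f \<alpha>) =
      (real N * (\<kappa> + 1/2) + 2 * real (weight \<alpha>)) * f \<alpha>"
    by (simp add: weight_eq_sum[OF assms] sum.distrib flip: sum_distrib_right sum_distrib_left)
  finally show ?thesis .
qed

section \<open>Symmetric coefficient functions and the operators in the monomial basis\<close>

definition symmetric_coefs :: "nat \<Rightarrow> (mindex \<Rightarrow> 'a) \<Rightarrow> bool" where
  "symmetric_coefs N f \<longleftrightarrow> (\<forall>\<alpha>\<in>mindices N. f (sort_desc N \<alpha>) = f \<alpha>)"

lemma symmetric_coefsD: "symmetric_coefs N f \<Longrightarrow> \<alpha> \<in> mindices N \<Longrightarrow> f (sort_desc N \<alpha>) = f \<alpha>"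
  by (simp add: symmetric_coefs_def)

text \<open>The definition compares an index only with its sorted form. Two indices that are
  permutations of each other share that form, which gives full permutation invariance.\<close>

lemma symmetric_coefs_permute:
  assumes f: "symmetric_coefs N f" and "\<alpha> \<in> mindices N" "\<beta> \<in> mindices N" "p permutes {..<N}"
    and "\<And>i. i < N \<Longrightarrow> coef \<beta> i = coef \<alpha> (p i)"
  shows "f \<beta> = f \<alpha>"
  using assms sort_desc_permute[of p N \<beta> \<alpha>] by (metis symmetric_coefsD)

lemma symmetric_raising:
  assumes f: "symmetric_coefs N f"
  shows "symmetric_coefs N (raising N f)"
  unfolding symmetric_coefs_def
proof
  fix \<alpha> assume \<alpha>: "\<alpha> \<in> mindices N"
  let ?s = "sort_desc N \<alpha>"
  obtain p where p: "p permutes {..<N}" "\<And>i. i < N \<Longrightarrow> coef \<alpha> i = coef ?s (p i)"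
    using sort_desc_permutation[of N \<alpha>] by blast
  \<comment> \<open>The permutation relating \<alpha> to its sorted form also relates the two
    lowered indices, which themselves need not be sorted.\<close>
  have "f (dec i \<alpha>) = f (dec (p i) ?s)" if "i < N" for i
    using \<alpha> that by (intro symmetric_coefs_permute[OF f _ _ p(1)])
      (auto simp: coef_dec p(2) inj_eq[OF permutes_inj[OF p(1)]])
  then have "raising N f \<alpha> = (\<Sum>i<N. if coef ?s (p i) = 0 then 0 else f (dec (p i) ?s))"
    unfolding raising_def by (intro sum.cong) (auto simp: p(2))
  also have "\<dots> = raising N f ?s"
    unfolding raising_def
    by (rule sum.permute[OF p(1), of "\<lambda>i. if coef ?s i = 0 then 0 else f (dec i ?s)", unfolded o_def, symmetric])
  finally show "raising N f ?s = raising N f \<alpha>" ..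
qed

lemma symmetric_lowering:
  assumes f: "symmetric_coefs N f"
  shows "symmetric_coefs N (lowering N \<kappa> f)"
  unfolding symmetric_coefs_def
proof
  fix \<alpha> assume \<alpha>: "\<alpha> \<in> mindices N"
  let ?s = "sort_desc N \<alpha>"
  obtain p where p: "p permutes {..<N}" "\<And>i. i < N \<Longrightarrow> coef \<alpha> i = coef ?s (p i)"
    using sort_desc_permutation[of N \<alpha>] by blast
  let ?g = "\<lambda>i. (real (coef ?s i) + 1) * (\<kappa> + 1/2 + real (coef ?s i)) * f (inc i ?s)"
  have "f (inc i \<alpha>) = f (inc (p i) ?s)" if "i < N" for i
    using \<alpha> that permutes_in_image[OF p(1), of i]
    by (intro symmetric_coefs_permute[OF f _ _ p(1)])
      (auto simp: coef_inc p(2) inj_eq[OF permutes_inj[OF p(1)]])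
  then have "lowering N \<kappa> f \<alpha> = (\<Sum>i<N. ?g (p i))"
    unfolding lowering_def by (intro sum.cong) (auto simp: p(2))
  also have "\<dots> = lowering N \<kappa> f ?s"
    unfolding lowering_def by (rule sum.permute[OF p(1), of ?g, unfolded o_def, symmetric])
  finally show "lowering N \<kappa> f ?s = lowering N \<kappa> f \<alpha>" ..
qed

text \<open>On \<open>mindices N\<close> this is the coefficient function of
  \<open>msym N \<nu>\<close>. Since \<open>sort_desc N\<close> reads only the first N entries, it
  may take the value 1 elsewhere too, hence the guard in \<open>coef_msym\<close>.\<close>

definition orbit_ind :: "nat \<Rightarrow> mindex \<Rightarrow> mindex \<Rightarrow> real" where
  "orbit_ind N \<nu> \<alpha> = (if sort_desc N \<alpha> = \<nu> then 1 else 0)"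

lemma symmetric_orbit_ind: "symmetric_coefs N (orbit_ind N \<nu>)"
  by (simp add: symmetric_coefs_def orbit_ind_def sort_desc_idem antimono_sort_desc)

lemma symmetric_coefs_expand:
  assumes "symmetric_coefs N f" "\<alpha> \<in> mindices N" "weight \<alpha> = n"
  shows "f \<alpha> = (\<Sum>\<nu>\<in>partitions N n. orbit_ind N \<nu> \<alpha> * f \<nu>)"
proof -
  have "(\<Sum>\<nu>\<in>partitions N n. orbit_ind N \<nu> \<alpha> * f \<nu>) = f (sort_desc N \<alpha>)"
    unfolding orbit_ind_def
    by (subst sum_delta_mult_left) (auto simp: finite_partitions sort_desc_partitions assms)
  then show ?thesis using symmetric_coefsD[OF assms(1,2)] by simp
qed

text \<open>Matrix form of multiplication by e1 from degree n to n + 1 in the monomial basis. The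
  expansion is inserted in each summand, because there \<open>dec i \<alpha>\<close> has weight n.
  \<open>lowering_expand\<close> is the counterpart one degree downwards.\<close>

lemma raising_expand:
  assumes "symmetric_coefs N f" "\<alpha> \<in> mindices N" "weight \<alpha> = Suc n"
  shows "raising N f \<alpha> = (\<Sum>\<nu>\<in>partitions N n. raising N (orbit_ind N \<nu>) \<alpha> * f \<nu>)"
proof -
  have "raising N f \<alpha> = (\<Sum>i<N. \<Sum>\<nu>\<in>partitions N n.
      (if coef \<alpha> i = 0 then 0 else orbit_ind N \<nu> (dec i \<alpha>)) * f \<nu>)"
    unfolding raising_def
  proof (intro sum.cong refl)
    fix i assume i: "i \<in> {..<N}"
    show "(if coef \<alpha> i = 0 then 0 else f (dec i \<alpha>)) = (\<Sum>\<nu>\<in>partitions N n.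
      (if coef \<alpha> i = 0 then 0 else orbit_ind N \<nu> (dec i \<alpha>)) * f \<nu>)"
      using symmetric_coefs_expand[of N f "dec i \<alpha>" n] weight_dec[of i N \<alpha>] assms i by simp
  qed
  also have "\<dots> = (\<Sum>\<nu>\<in>partitions N n. raising N (orbit_ind N \<nu>) \<alpha> * f \<nu>)"
    by (subst sum.swap) (simp add: raising_def sum_distrib_right)
  finally show ?thesis .
qed

lemma lowering_expand:
  assumes "symmetric_coefs N f" "\<alpha> \<in> mindices N" "weight \<alpha> = n"
  shows "lowering N \<kappa> f \<alpha> = (\<Sum>\<nu>\<in>partitions N (Suc n). lowering N \<kappa> (orbit_ind N \<nu>) \<alpha> * f \<nu>)"
proof -
  have "lowering N \<kappa> f \<alpha> = (\<Sum>i<N. \<Sum>\<nu>\<in>partitions N (Suc n).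
      (real (coef \<alpha> i) + 1) * (\<kappa> + 1/2 + real (coef \<alpha> i)) * orbit_ind N \<nu> (inc i \<alpha>) * f \<nu>)"
    unfolding lowering_def
  proof (intro sum.cong refl)
    fix i assume i: "i \<in> {..<N}"
    show "(real (coef \<alpha> i) + 1) * (\<kappa> + 1/2 + real (coef \<alpha> i)) * f (inc i \<alpha>) = (\<Sum>\<nu>\<in>partitions N (Suc n).
      (real (coef \<alpha> i) + 1) * (\<kappa> + 1/2 + real (coef \<alpha> i)) * orbit_ind N \<nu> (inc i \<alpha>) * f \<nu>)"
      using symmetric_coefs_expand[of N f "inc i \<alpha>" "Suc n"] weight_inc[of i N \<alpha>] assms i
      by (simp add: mult.assoc flip: sum_distrib_left)
  qed
  also have "\<dots> = (\<Sum>\<nu>\<in>partitions N (Suc n). lowering N \<kappa> (orbit_ind N \<nu>) \<alpha> * f \<nu>)"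
    by (subst sum.swap) (simp add: lowering_def sum_distrib_right)
  finally show ?thesis .
qed

section \<open>Norms of orbit sums and the adjoint of multiplication by e1\<close>

definition orbit :: "nat \<Rightarrow> mindex \<Rightarrow> mindex set" where
  "orbit N \<nu> = {\<alpha> \<in> mindices N. sort_desc N \<alpha> = \<nu>}"

lemma finite_orbit: "finite (orbit N \<nu>)"
  using finite_rearrangements[of N \<nu>] by (simp add: orbit_def mindices_def)

text \<open>The squared norm of the monomial with exponent 2\<alpha> is
  \<open>4 ^ weight \<alpha>\<close> times this number, see
  \<open>dunkl_norm_double\<close>.\<close>

definition mweight :: "nat \<Rightarrow> real \<Rightarrow> mindex \<Rightarrow> real" where
  "mweight N \<kappa> \<alpha> = (\<Prod>i<N. fact (coef \<alpha> i) * pochhammer (\<kappa> + 1/2) (coef \<alpha> i))"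

text \<open>The ratio of the weights is exactly the coefficient occurring in
  \<open>lowering\<close>; this makes \<open>lowering\<close> the adjoint of
  \<open>raising\<close>.\<close>

lemma mweight_inc:
  assumes "i < N"
  shows "mweight N \<kappa> (inc i \<alpha>) =
    mweight N \<kappa> \<alpha> * ((real (coef \<alpha> i) + 1) * (\<kappa> + 1/2 + real (coef \<alpha> i)))"
proof -
  let ?g = "\<lambda>a. fact a * pochhammer (\<kappa> + 1/2) a"
  have "mweight N \<kappa> (inc i \<alpha>) = ?g (Suc (coef \<alpha> i)) * (\<Prod>j\<in>{..<N} - {i}. ?g (coef \<alpha> j))"
    using assms unfolding mweight_def
    by (subst prod.remove[of _ i]) (auto simp: coef_inc intro!: prod.cong)
  moreover have "mweight N \<kappa> \<alpha> = ?g (coef \<alpha> i) * (\<Prod>j\<in>{..<N} - {i}. ?g (coef \<alpha> j))"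
    using assms unfolding mweight_def by (subst prod.remove[of _ i]) auto
  ultimately show ?thesis by (simp add: pochhammer_Suc mult_ac add_ac)
qed

text \<open>The number c(nu) of the overview, with the value of the monomial symmetric polynomial at
  1^N written as the size of the orbit (\<open>orbit_norm_eq\<close>).\<close>

definition orbit_norm :: "nat \<Rightarrow> real \<Rightarrow> mindex \<Rightarrow> real" where
  "orbit_norm N \<kappa> \<nu> = mweight N \<kappa> \<nu> * real (card (orbit N \<nu>))"

text \<open>Pairing f with an orbit sum: both the weight and f are constant on the orbit, so a
  single coefficient of f survives.\<close>

lemma orbit_norm_sum:
  assumes "symmetric_coefs N f" "\<nu> \<in> mindices N"
  shows "(\<Sum>\<alpha>\<in>orbit N \<nu>. mweight N \<kappa> \<alpha> * f \<alpha>) = orbit_norm N \<kappa> \<nu> * f \<nu>"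
proof -
  have "mweight N \<kappa> \<alpha> * f \<alpha> = mweight N \<kappa> \<nu> * f \<nu>" if "\<alpha> \<in> orbit N \<nu>" for \<alpha>
  proof -
    have s: "sort_desc N \<alpha> = \<nu>" "\<alpha> \<in> mindices N" using that by (auto simp: orbit_def)
    have "mweight N \<kappa> \<alpha> = mweight N \<kappa> \<nu>"
      unfolding mweight_def s(1)[symmetric] by (rule prod_sort_desc[symmetric])
    then show ?thesis using symmetric_coefsD[OF assms(1) s(2)] s(1) by simp
  qed
  then show ?thesis by (simp add: orbit_norm_def)
qed

text \<open>Both sides are the weighted pairing of e1 times the orbit sum of \<mu> with the orbit
  sum of \<nu>. It is a count of pairs of indices differing by 1 at one position, summed once over
  the larger and once over the smaller index.\<close>

lemma raising_adjoint:
  assumes "\<nu> \<in> mindices N" "\<mu> \<in> mindices N"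
  shows "orbit_norm N \<kappa> \<nu> * raising N (orbit_ind N \<mu>) \<nu> =
    orbit_norm N \<kappa> \<mu> * lowering N \<kappa> (orbit_ind N \<nu>) \<mu>"
proof -
  have "orbit_norm N \<kappa> \<nu> * raising N (orbit_ind N \<mu>) \<nu> =
      (\<Sum>\<alpha>\<in>orbit N \<nu>. mweight N \<kappa> \<alpha> * raising N (orbit_ind N \<mu>) \<alpha>)"
    using assms by (intro orbit_norm_sum[symmetric] symmetric_raising symmetric_orbit_ind)
  also have "\<dots> = (\<Sum>i<N. \<Sum>\<alpha>\<in>orbit N \<nu>.
      if coef \<alpha> i \<noteq> 0 \<and> dec i \<alpha> \<in> orbit N \<mu> then mweight N \<kappa> \<alpha> else 0)"
    unfolding raising_def sum_distrib_left
    by (subst sum.swap) (auto intro!: sum.cong simp: orbit_ind_def orbit_def)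
  also have "\<dots> = (\<Sum>i<N. \<Sum>\<alpha> | \<alpha> \<in> orbit N \<nu> \<and> coef \<alpha> i \<noteq> 0 \<and> dec i \<alpha> \<in> orbit N \<mu>. mweight N \<kappa> \<alpha>)"
    by (simp add: sum.inter_filter finite_orbit)
  \<comment> \<open>The condition that entry i of \<alpha> is nonzero makes \<open>inc i\<close> and
    \<open>dec i\<close> inverse bijections between the two index sets.\<close>
  also have "\<dots> = (\<Sum>i<N. \<Sum>\<beta> | \<beta> \<in> orbit N \<mu> \<and> inc i \<beta> \<in> orbit N \<nu>. mweight N \<kappa> (inc i \<beta>))"
    by (intro sum.cong refl sum.reindex_bij_witness[of _ "inc i" "dec i" for i])
      (auto simp: coef_inc)
  also have "\<dots> = (\<Sum>i<N. \<Sum>\<beta>\<in>orbit N \<mu>. if inc i \<beta> \<in> orbit N \<nu> then mweight N \<kappa> (inc i \<beta>) else 0)"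
    by (simp add: sum.inter_filter finite_orbit)
  also have "\<dots> = (\<Sum>\<beta>\<in>orbit N \<mu>. mweight N \<kappa> \<beta> * lowering N \<kappa> (orbit_ind N \<nu>) \<beta>)"
    unfolding lowering_def sum_distrib_left
    by (subst sum.swap) (auto intro!: sum.cong simp: orbit_ind_def orbit_def mweight_inc)
  also have "\<dots> = orbit_norm N \<kappa> \<mu> * lowering N \<kappa> (orbit_ind N \<nu>) \<mu>"
    using assms by (intro orbit_norm_sum symmetric_lowering symmetric_orbit_ind)
  finally show ?thesis .
qed

lemma orbit_norm_pos:
  assumes "\<kappa> \<ge> 0" "\<nu> \<in> partitions N n"
  shows "orbit_norm N \<kappa> \<nu> > 0"
proof -
  have "\<nu> \<in> orbit N \<nu>" using assms(2) by (auto simp: orbit_def partitions_iff sort_desc_idem)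
  then have "card (orbit N \<nu>) > 0" using finite_orbit by (auto simp: card_gt_0_iff)
  moreover have "mweight N \<kappa> \<nu> > 0"
    unfolding mweight_def using assms(1) by (intro prod_pos) (auto intro!: mult_pos_pos pochhammer_pos)
  ultimately show ?thesis by (simp add: orbit_norm_def)
qed

section \<open>Coefficients of symmetric polynomials\<close>

lemma coef_cpoly_mult: "coef (cpoly c * p) \<alpha> = c * coef p \<alpha>"
  by (simp add: cpoly_def lookup_mult lookup_single when_mult)

lemma coef_X_mult: "coef (X i * p) \<alpha> = (if coef \<alpha> i = 0 then 0 else coef p (dec i \<alpha>))"
proof -
  have iff: "\<alpha> = Poly_Mapping.single i 1 + q \<longleftrightarrow> coef \<alpha> i \<noteq> 0 \<and> q = dec i \<alpha>" for q
    unfolding inc_eq_add[symmetric] by (auto simp: coef_inc)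
  have "coef (X i * p) \<alpha> = (\<Sum>q. coef p q when \<alpha> = Poly_Mapping.single i 1 + q)"
    by (simp add: X_def xpow_def lookup_mult lookup_single when_mult)
  also have "\<dots> = (\<Sum>q. (coef p q when q = dec i \<alpha>) when coef \<alpha> i \<noteq> 0)"
    unfolding iff by (simp add: when_when conj_commute)
  finally show ?thesis by (cases "coef \<alpha> i = 0") simp_all
qed

lemma coef_e1_mult: "coef (e1 N * p) = raising N (coef p)"
  by (rule ext) (simp add: e1_def sum_distrib_right lookup_sum coef_X_mult raising_def)

lemma coef_xpow: "coef (xpow \<alpha>) \<beta> = (if \<alpha> = \<beta> then 1 else 0)"
  by (simp add: xpow_def lookup_single when_def)

lemma msym_eq_sum: "msym N \<nu> = (\<Sum>\<alpha>\<in>orbit N \<nu>. xpow \<alpha>)"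
  by (simp add: msym_def orbit_def mindices_def)

lemma coef_msym: "coef (msym N \<nu>) \<alpha> = (if \<alpha> \<in> mindices N then orbit_ind N \<nu> \<alpha> else 0)"
  by (simp add: msym_eq_sum lookup_sum coef_xpow finite_orbit) (simp add: orbit_def orbit_ind_def)

lemma tmsym_tpartition: "\<mu> \<in> tpartitions N n \<Longrightarrow> tmsym N \<mu> = msym N \<mu>"
proof -
  assume \<mu>: "\<mu> \<in> tpartitions N n"
  have "Poly_Mapping.update 0 (coef \<mu> 1) \<mu> = \<mu>"
    using \<mu> by (intro poly_mapping_eqI) (simp add: lookup_update tpartitions_def)
  then show ?thesis using \<mu> by (simp add: tmsym_def tpartitions_def)
qed

lemma tmsym_inc:
  assumes "\<mu> \<in> partitions N n"
  shows "tmsym N (inc 0 \<mu>) = e1 N * tmsym N \<mu>"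
proof -
  have "coef \<mu> 1 \<le> coef \<mu> 0" using assms by (auto simp: partitions_iff dest: antimonoD)
  then have "coef (inc 0 \<mu>) 0 - coef (inc 0 \<mu>) 1 = Suc (coef \<mu> 0 - coef \<mu> 1)"
    by (simp add: coef_inc Suc_diff_le)
  moreover have "Poly_Mapping.update 0 (coef (inc 0 \<mu>) 1) (inc 0 \<mu>) = Poly_Mapping.update 0 (coef \<mu> 1) \<mu>"
    by (rule poly_mapping_eqI) (simp add: lookup_update coef_inc)
  ultimately show ?thesis by (simp add: tmsym_def mult.assoc)
qed

lemma raising_nonzeroE:
  assumes "raising N f \<alpha> \<noteq> 0"
  obtains i where "i < N" "coef \<alpha> i \<noteq> 0" "f (dec i \<alpha>) \<noteq> 0"
proof -
  obtain i where "i \<in> {..<N}" "(if coef \<alpha> i = 0 then 0 else f (dec i \<alpha>)) \<noteq> 0"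
    using assms unfolding raising_def by (rule sum.not_neutral_contains_not_neutral)
  then show ?thesis by (intro that[of i]) (auto split: if_splits)
qed

text \<open>Every partition arises from one with equal first two parts by enlarging the first part.
  Along this induction \<open>tmsym\<close> starts as a monomial symmetric polynomial and is then
  multiplied by e1.\<close>

lemma partitions_induct [consumes 2, case_names tpartition inc]:
  assumes "N \<ge> 1" "\<mu> \<in> partitions N n"
    and t: "\<And>n \<mu>. \<mu> \<in> tpartitions N n \<Longrightarrow> P n \<mu>"
    and i: "\<And>n \<mu>. \<mu> \<in> partitions N n \<Longrightarrow> P n \<mu> \<Longrightarrow> P (Suc n) (inc 0 \<mu>)"
  shows "P n \<mu>"
  using assms(2)
proof (induction n arbitrary: \<mu>)
  case 0
  then have "\<mu> \<in> tpartitions N 0" by (auto simp: tpartitions_def partitions_0)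
  then show ?case by (rule t)
next
  case (Suc n)
  then consider "\<mu> \<in> tpartitions N (Suc n)" | \<nu> where "\<nu> \<in> partitions N n" "\<mu> = inc 0 \<nu>"
    using partitions_Suc(1)[OF assms(1)] by auto
  then show ?case by cases (use t i Suc.IH in auto)
qed

lemma tmsym_support:
  assumes "N \<ge> 1" "\<mu> \<in> partitions N n" "coef (tmsym N \<mu>) \<alpha> \<noteq> 0"
  shows "\<alpha> \<in> mindices N \<and> weight \<alpha> = n"
  using assms
proof (induction arbitrary: \<alpha> rule: partitions_induct)
  case (tpartition n \<mu>)
  then show ?case
    using weight_sort_desc[of \<alpha> N]
    by (auto simp: tmsym_tpartition coef_msym orbit_ind_def tpartitions_def partitions_iff split: if_splits)
next
  case (inc n \<mu>)
  then have "raising N (coef (tmsym N \<mu>)) \<alpha> \<noteq> 0" by (simp add: tmsym_inc coef_e1_mult)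
  then obtain i where i: "i < N" "coef \<alpha> i \<noteq> 0" "coef (tmsym N \<mu>) (dec i \<alpha>) \<noteq> 0"
    by (rule raising_nonzeroE)
  from inc.IH[OF i(3)] i(1,2) show ?case
    using weight_dec[of i N \<alpha>] by (simp add: dec_mindices_iff)
qed

lemma symmetric_tmsym:
  assumes "N \<ge> 1" "\<mu> \<in> partitions N n"
  shows "symmetric_coefs N (coef (tmsym N \<mu>))"
  using assms
proof (induction rule: partitions_induct)
  case (tpartition n \<mu>)
  show ?case
    using symmetric_orbit_ind[of N \<mu>]
    by (simp add: symmetric_coefs_def tmsym_tpartition[OF tpartition] coef_msym)
qed (simp add: tmsym_inc coef_e1_mult symmetric_raising)

text \<open>A nonzero coefficient of e1 times p at \<nu> comes from one of p at some
  \<open>dec i \<nu>\<close>. That index need not be a partition, so the induction hypothesis is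
  applied to its sorted form, and \<open>sort_desc_le\<close> bounds the result by \<nu>. Enlarging
  the first part of \<mu> leaves the compared parts alone.\<close>

lemma tmsym_triangular:
  assumes "N \<ge> 1" "\<mu> \<in> partitions N n" "\<nu> \<in> partitions N n" "coef (tmsym N \<mu>) \<nu> \<noteq> 0"
  shows "prec \<nu> \<mu>"
proof -
  have "coef \<mu> k \<le> coef \<nu> k" if "k \<ge> 1" for k
    using assms that
  proof (induction arbitrary: \<nu> rule: partitions_induct)
    case (tpartition n \<mu>)
    then show ?case
      by (auto simp: tmsym_tpartition coef_msym orbit_ind_def split: if_splits)
  next
    case (inc n \<mu>)
    have \<nu>: "\<nu> \<in> mindices N" "antimono (coef \<nu>)" "weight \<nu> = Suc n"
      using inc.prems by (auto simp: partitions_iff)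
    have "raising N (coef (tmsym N \<mu>)) \<nu> \<noteq> 0" using inc by (simp add: tmsym_inc coef_e1_mult)
    then obtain i where i: "i < N" "coef \<nu> i \<noteq> 0" "coef (tmsym N \<mu>) (dec i \<nu>) \<noteq> 0"
      by (rule raising_nonzeroE)
    have "weight (dec i \<nu>) = n" using weight_dec[OF i(1) \<nu>(1) i(2)] \<nu>(3) by simp
    then have "sort_desc N (dec i \<nu>) \<in> partitions N n" using \<nu>(1) by (simp add: sort_desc_partitions)
    moreover have "coef (tmsym N \<mu>) (sort_desc N (dec i \<nu>)) \<noteq> 0"
      using symmetric_coefsD[OF symmetric_tmsym[OF assms(1) inc.hyps(1)], of "dec i \<nu>"] i(3) \<nu>(1)
      by simp
    ultimately have "coef \<mu> k \<le> coef (sort_desc N (dec i \<nu>)) k"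
      using inc.IH inc.prems by blast
    also have "\<dots> \<le> coef \<nu> k" by (rule sort_desc_le[OF \<nu>(2)]) (simp add: coef_dec)
    finally show ?case using inc.prems by (simp add: coef_inc)
  qed
  then show ?thesis using assms(2,3) by (simp add: prec_def partitions_iff)
qed

lemma prec_trans: "prec \<rho> \<nu> \<Longrightarrow> prec \<nu> \<mu> \<Longrightarrow> prec \<rho> \<mu>"
  by (auto simp: prec_def intro: order_trans)

text \<open>The relation bounds all parts except the first; with that bound added, \<mu> is below
  \<nu> in every part while the sums agree.\<close>

lemma prec_imp_eq:
  assumes "N \<ge> 1" "\<nu> \<in> mindices N" "\<mu> \<in> mindices N" "prec \<nu> \<mu>" "coef \<mu> 0 \<le> coef \<nu> 0"
  shows "\<nu> = \<mu>"
proof (rule mindices_eqI)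
  have le: "coef \<mu> i \<le> coef \<nu> i" for i
    using assms(4,5) by (cases i) (auto simp: prec_def)
  have "(\<Sum>i<N. coef \<mu> i) = (\<Sum>i<N. coef \<nu> i)"
    using assms(2-4) by (simp add: prec_def weight_eq_sum[of _ N])
  then show "coef \<nu> i = coef \<mu> i" if "i < N" for i
    using sum_mono_inv[of "coef \<mu>" "{..<N}" "coef \<nu>" i] le that by simp
qed (use assms in auto)

text \<open>Only lowering at position 0 contributes to the coefficient at
  \<open>inc 0 \<mu>\<close>. Lowering at another position keeps an entry larger than the first part
  of \<mu>, and triangularity rules out a nonzero coefficient at such an index.\<close>

lemma tmsym_diagonal:
  assumes "N \<ge> 1" "\<mu> \<in> partitions N n"
  shows "coef (tmsym N \<mu>) \<mu> = 1"
  using assms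
proof (induction rule: partitions_induct)
  case (tpartition n \<mu>)
  then have "\<mu> \<in> partitions N n" by (simp add: tpartitions_def)
  then show ?case
    by (simp add: tmsym_tpartition[OF tpartition] coef_msym orbit_ind_def) (simp add: partitions_iff)
next
  case (inc n \<mu>)
  let ?\<nu> = "inc 0 \<mu>"
  have \<mu>: "\<mu> \<in> mindices N" "weight \<mu> = n" using inc.hyps by (auto simp: partitions_iff)
  have "(if coef ?\<nu> i = 0 then 0 else coef (tmsym N \<mu>) (dec i ?\<nu>)) = (if i = 0 then 1 else 0)"
    if "i < N" for i
  proof (cases "i = 0 \<or> coef ?\<nu> i = 0")
    case True
    then show ?thesis using inc.IH by (auto simp: coef_inc)
  next
    case False
    have "coef (tmsym N \<mu>) (dec i ?\<nu>) = 0"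
    proof (rule ccontr)
      let ?s = "sort_desc N (dec i ?\<nu>)"
      assume nz: "coef (tmsym N \<mu>) (dec i ?\<nu>) \<noteq> 0"
      have m: "dec i ?\<nu> \<in> mindices N" using \<mu>(1) assms(1) by simp
      have w: "weight (dec i ?\<nu>) = n"
        using tmsym_support[OF assms(1) inc.hyps nz] by simp
      have s: "?s \<in> partitions N n" using m w by (rule sort_desc_partitions)
      have "coef (tmsym N \<mu>) ?s \<noteq> 0"
        using symmetric_coefsD[OF symmetric_tmsym[OF assms(1) inc.hyps] m] nz by simp
      then have p: "prec ?s \<mu>" by (rule tmsym_triangular[OF assms(1) inc.hyps s])
      have "Suc (coef \<mu> 0) = coef (dec i ?\<nu>) 0" using False by (simp add: coef_dec coef_inc)
      also have "\<dots> \<le> coef ?s 0" using assms(1) by (intro coef_le_sort_desc_0) simp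
      finally have gt: "coef \<mu> 0 < coef ?s 0" by simp
      have "?s = \<mu>" using gt s \<mu> p assms(1)
        by (intro prec_imp_eq[of N]) (auto simp: partitions_iff)
      then show False using gt by simp
    qed
    then show ?thesis using False by simp
  qed
  then have "raising N (coef (tmsym N \<mu>)) ?\<nu> = (\<Sum>i<N. if i = 0 then 1 else 0)"
    unfolding raising_def by (intro sum.cong) auto
  then show ?case using assms(1) by (simp add: tmsym_inc[OF inc.hyps] coef_e1_mult)
qed

text \<open>If the first part of \<nu> were not smaller, \<open>prec_imp_eq\<close> would force
  equality. The first part is thus the rank that drives the recursion for the coordinates, the
  independence proof and the determinant of A.\<close>

lemma tmsym_strictly_triangular:
  assumes "N \<ge> 1" "\<mu> \<in> partitions N n" "\<nu> \<in> partitions N n" "coef (tmsym N \<mu>) \<nu> \<noteq> 0" "\<nu> \<noteq> \<mu>"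
  shows "coef \<nu> 0 < coef \<mu> 0"
  using tmsym_triangular[OF assms(1-4)] prec_imp_eq[of N \<nu> \<mu>] assms
  by (auto simp: partitions_iff not_le[symmetric])

lemma tmsym_expand:
  assumes "N \<ge> 1" "\<mu> \<in> partitions N n"
  shows "tmsym N \<mu> = (\<Sum>\<nu>\<in>partitions N n. cpoly (coef (tmsym N \<mu>) \<nu>) * msym N \<nu>)"
proof (rule poly_mapping_eqI)
  fix \<alpha>
  have "coef (tmsym N \<mu>) \<alpha> = (\<Sum>\<nu>\<in>partitions N n. coef (tmsym N \<mu>) \<nu> * coef (msym N \<nu>) \<alpha>)"
  proof (cases "\<alpha> \<in> mindices N \<and> weight \<alpha> = n")
    case True
    then show ?thesis
      using symmetric_coefs_expand[OF symmetric_tmsym[OF assms], of \<alpha> n]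
      by (simp add: coef_msym mult.commute)
  next
    case False
    then have "coef (msym N \<nu>) \<alpha> = 0" if "\<nu> \<in> partitions N n" for \<nu>
      using that weight_sort_desc[of \<alpha> N] by (auto simp: coef_msym orbit_ind_def partitions_iff)
    then show ?thesis using False tmsym_support[OF assms, of \<alpha>] by (auto intro!: sum.neutral[symmetric])
  qed
  then show "coef (tmsym N \<mu>) \<alpha> =
      coef (\<Sum>\<nu>\<in>partitions N n. cpoly (coef (tmsym N \<mu>) \<nu>) * msym N \<nu>) \<alpha>"
    by (simp add: lookup_sum coef_cpoly_mult)
qed

section \<open>Coordinates of monomial symmetric polynomials in the modified basis\<close>

lemma cpoly_add: "cpoly (a + b) = cpoly a + cpoly b"
  and cpoly_mult: "cpoly (a * b) = cpoly a * cpoly b"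
  and cpoly_minus: "cpoly (a - b) = cpoly a - cpoly b"
  and cpoly_0: "cpoly 0 = 0"
  and cpoly_1: "cpoly 1 = 1"
  by (simp_all add: cpoly_def single_add mult_single single_diff)

lemma cpoly_sum: "cpoly (sum f A) = (\<Sum>a\<in>A. cpoly (f a))"
  by (induction A rule: infinite_finite_induct) (simp_all add: cpoly_0 cpoly_add)

text \<open>The unitriangular system is solved by recursion on the first part. The support condition
  is carried along by transitivity of \<open>prec\<close>.\<close>

lemma ex_tmsym_coordinates:
  assumes "N \<ge> 1" "\<nu> \<in> partitions N n"
  shows "\<exists>b. (\<forall>\<rho>. b \<rho> \<noteq> 0 \<longrightarrow> \<rho> \<in> partitions N n \<and> prec \<rho> \<nu>) \<and>
    msym N \<nu> = (\<Sum>\<rho>\<in>partitions N n. cpoly (b \<rho>) * tmsym N \<rho>)"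
  using assms(2)
proof (induction "coef \<nu> 0" arbitrary: \<nu> rule: less_induct)
  case less
  let ?P = "partitions N n" and ?A = "\<lambda>\<mu>. coef (tmsym N \<nu>) \<mu>"
  let ?S = "{\<mu> \<in> ?P. ?A \<mu> \<noteq> 0 \<and> \<mu> \<noteq> \<nu>}"
  have "\<forall>\<mu>\<in>?S. \<exists>b. (\<forall>\<rho>. b \<rho> \<noteq> 0 \<longrightarrow> \<rho> \<in> ?P \<and> prec \<rho> \<mu>) \<and>
      msym N \<mu> = (\<Sum>\<rho>\<in>?P. cpoly (b \<rho>) * tmsym N \<rho>)"
    using less tmsym_strictly_triangular[OF assms(1) less.prems] by blast
  from bchoice[OF this] obtain b where
    "\<forall>\<mu>\<in>?S. (\<forall>\<rho>. b \<mu> \<rho> \<noteq> 0 \<longrightarrow> \<rho> \<in> ?P \<and> prec \<rho> \<mu>) \<and>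
      msym N \<mu> = (\<Sum>\<rho>\<in>?P. cpoly (b \<mu> \<rho>) * tmsym N \<rho>)"
    by (elim exE)
  then have b: "\<And>\<mu> \<rho>. \<mu> \<in> ?S \<Longrightarrow> b \<mu> \<rho> \<noteq> 0 \<Longrightarrow> \<rho> \<in> ?P \<and> prec \<rho> \<mu>"
    and b_eq: "\<And>\<mu>. \<mu> \<in> ?S \<Longrightarrow> msym N \<mu> = (\<Sum>\<rho>\<in>?P. cpoly (b \<mu> \<rho>) * tmsym N \<rho>)"
    by blast+
  \<comment> \<open>Solving the expansion of \<open>tmsym N \<nu>\<close> for its diagonal term:
    \<open>msym N \<nu>\<close> is \<open>tmsym N \<nu>\<close> minus terms with smaller first part,
    whose coordinates \<open>b\<close> are already known.\<close>
  define b' where "b' \<rho> = (if \<rho> = \<nu> then 1 else 0) - (\<Sum>\<mu>\<in>?S. ?A \<mu> * b \<mu> \<rho>)" for \<rho>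
  have "\<rho> \<in> ?P \<and> prec \<rho> \<nu>" if "b' \<rho> \<noteq> 0" for \<rho>
  proof (cases "\<rho> = \<nu>")
    case True
    then show ?thesis using less.prems by (simp add: prec_def)
  next
    case False
    then have "(\<Sum>\<mu>\<in>?S. ?A \<mu> * b \<mu> \<rho>) \<noteq> 0" using that by (simp add: b'_def)
    then obtain \<mu> where \<mu>: "\<mu> \<in> ?S" "b \<mu> \<rho> \<noteq> 0" by (metis (no_types, lifting) mult_zero_right sum.neutral)
    have "prec \<mu> \<nu>" using \<mu>(1) tmsym_triangular[OF assms(1) less.prems] by blast
    then show ?thesis using b[OF \<mu>] prec_trans by blast
  qed
  moreover have "msym N \<nu> = (\<Sum>\<rho>\<in>?P. cpoly (b' \<rho>) * tmsym N \<rho>)"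
  proof -
    have "tmsym N \<nu> = (\<Sum>\<mu>\<in>?P. cpoly (?A \<mu>) * msym N \<mu>)"
      by (rule tmsym_expand[OF assms(1) less.prems])
    also have "\<dots> = (\<Sum>\<mu>\<in>insert \<nu> ?S. cpoly (?A \<mu>) * msym N \<mu>)"
      by (rule sum.mono_neutral_right) (auto simp: finite_partitions less.prems cpoly_0)
    also have "\<dots> = msym N \<nu> + (\<Sum>\<mu>\<in>?S. cpoly (?A \<mu>) * msym N \<mu>)"
      by (subst sum.insert) (auto simp: finite_partitions tmsym_diagonal[OF assms(1) less.prems] cpoly_1)
    also have "(\<Sum>\<mu>\<in>?S. cpoly (?A \<mu>) * msym N \<mu>) = (\<Sum>\<rho>\<in>?P. cpoly (\<Sum>\<mu>\<in>?S. ?A \<mu> * b \<mu> \<rho>) * tmsym N \<rho>)"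
      by (simp add: b_eq sum_distrib_left sum_distrib_right cpoly_sum cpoly_mult mult.assoc sum.swap[of _ ?P])
    finally have diff: "msym N \<nu> = tmsym N \<nu> - (\<Sum>\<rho>\<in>?P. cpoly (\<Sum>\<mu>\<in>?S. ?A \<mu> * b \<mu> \<rho>) * tmsym N \<rho>)"
      by (simp add: algebra_simps)
    have "tmsym N \<nu> = (\<Sum>\<rho>\<in>?P. if \<rho> = \<nu> then tmsym N \<rho> else 0)"
      using less.prems by (simp add: finite_partitions)
    also have "\<dots> = (\<Sum>\<rho>\<in>?P. cpoly (if \<rho> = \<nu> then 1 else 0) * tmsym N \<rho>)"
      by (intro sum.cong) (auto simp: cpoly_0 cpoly_1)
    finally have unit: "tmsym N \<nu> = (\<Sum>\<rho>\<in>?P. cpoly (if \<rho> = \<nu> then 1 else 0) * tmsym N \<rho>)" .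
    show ?thesis
      unfolding b'_def cpoly_minus left_diff_distrib sum_subtractf unit[symmetric] by (rule diff)
  qed
  ultimately show ?case by blast
qed

text \<open>Take an index \<mu> with nonzero coefficient and maximal first part and read off the
  coefficient at \<mu>. Any other contributing index would have a larger first part, so only the
  diagonal term is left.\<close>

lemma tmsym_independent:
  assumes "N \<ge> 1" and zero: "(\<Sum>\<rho>\<in>partitions N n. cpoly (b \<rho>) * tmsym N \<rho>) = 0"
    and "\<rho> \<in> partitions N n"
  shows "b \<rho> = 0"
proof (rule ccontr)
  let ?P = "partitions N n"
  let ?S = "{\<rho> \<in> ?P. b \<rho> \<noteq> 0}"
  assume "b \<rho> \<noteq> 0"
  then have "?S \<noteq> {}" "finite ?S" using assms(3) by (auto simp: finite_partitions)
  then obtain \<mu> where \<mu>: "\<mu> \<in> ?S" and max: "\<And>\<nu>. \<nu> \<in> ?S \<Longrightarrow> coef \<nu> 0 \<le> coef \<mu> 0"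
    using obtains_MAX[of ?S "\<lambda>\<nu>. coef \<nu> 0"] Max_ge by (metis (no_types, lifting) finite_imageI image_eqI)
  have "0 = (\<Sum>\<rho>\<in>?P. b \<rho> * coef (tmsym N \<rho>) \<mu>)"
    using arg_cong[OF zero, of "\<lambda>p. coef p \<mu>"] by (simp add: lookup_sum coef_cpoly_mult)
  also have "\<dots> = (\<Sum>\<rho>\<in>?P. if \<rho> = \<mu> then b \<mu> else 0)"
  proof (intro sum.cong refl)
    fix \<rho> assume \<rho>: "\<rho> \<in> ?P"
    show "b \<rho> * coef (tmsym N \<rho>) \<mu> = (if \<rho> = \<mu> then b \<mu> else 0)"
      using tmsym_diagonal[OF assms(1) \<rho>] tmsym_strictly_triangular[OF assms(1) \<rho>, of \<mu>] \<mu> max[of \<rho>] \<rho>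
      by (cases "\<rho> = \<mu>") force+
  qed
  also have "\<dots> = b \<mu>" using \<mu> by (simp add: finite_partitions)
  finally show False using \<mu> by simp
qed

text \<open>Existence and independence justify the definite description defining \<open>B\<close>.
  The support statement is kept because the sum defining \<open>h\<close> ranges over indices
  related by \<open>prec\<close>.\<close>

lemma B_coordinates:
  assumes "N \<ge> 1" "\<nu> \<in> partitions N n"
  shows "B N \<mu> \<nu> \<noteq> 0 \<Longrightarrow> \<mu> \<in> partitions N n \<and> prec \<mu> \<nu>"
    and "msym N \<nu> = (\<Sum>\<rho>\<in>partitions N n. cpoly (B N \<rho> \<nu>) * tmsym N \<rho>)"
proof -
  let ?P = "partitions N n"
  let ?Q = "\<lambda>b. (\<forall>\<rho>. \<rho> \<notin> ?P \<longrightarrow> b \<rho> = 0) \<and> msym N \<nu> = (\<Sum>\<rho>\<in>?P. cpoly (b \<rho>) * tmsym N \<rho>)"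
  obtain b where b: "\<And>\<rho>. b \<rho> \<noteq> 0 \<Longrightarrow> \<rho> \<in> ?P \<and> prec \<rho> \<nu>"
    and eq: "msym N \<nu> = (\<Sum>\<rho>\<in>?P. cpoly (b \<rho>) * tmsym N \<rho>)"
    using ex_tmsym_coordinates[OF assms] by blast
  have "(THE b. ?Q b) = b"
  proof (rule the_equality)
    show "?Q b" using b eq by blast
    fix b' assume b': "?Q b'"
    then have "(\<Sum>\<rho>\<in>?P. cpoly (b' \<rho> - b \<rho>) * tmsym N \<rho>) = 0"
      using eq by (simp add: cpoly_minus left_diff_distrib sum_subtractf)
    then have "b' \<rho> = b \<rho>" if "\<rho> \<in> ?P" for \<rho>
      using tmsym_independent[OF assms(1) _ that, of "\<lambda>\<rho>. b' \<rho> - b \<rho>"] by simp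
    then show "b' = b" using b' b by (intro ext) metis
  qed
  moreover have "weight \<nu> = n" using assms(2) by (simp add: partitions_iff)
  ultimately have "B N \<mu> \<nu> = b \<mu>" for \<mu> by (simp add: B_def)
  then show "B N \<mu> \<nu> \<noteq> 0 \<Longrightarrow> \<mu> \<in> ?P \<and> prec \<mu> \<nu>"
    and "msym N \<nu> = (\<Sum>\<rho>\<in>?P. cpoly (B N \<rho> \<nu>) * tmsym N \<rho>)"
    using b eq by auto
qed

lemma tmsym_mult_B:
  assumes "N \<ge> 1" "\<mu> \<in> partitions N n" "\<nu> \<in> partitions N n"
  shows "(\<Sum>\<rho>\<in>partitions N n. coef (tmsym N \<rho>) \<mu> * B N \<rho> \<nu>) = (if \<mu> = \<nu> then 1 else 0)"
proof -
  have "coef (msym N \<nu>) \<mu> = (\<Sum>\<rho>\<in>partitions N n. coef (tmsym N \<rho>) \<mu> * B N \<rho> \<nu>)"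
    by (subst B_coordinates(2)[OF assms(1,3)]) (simp add: lookup_sum coef_cpoly_mult, simp add: mult.commute)
  moreover have "coef (msym N \<nu>) \<mu> = (if \<mu> = \<nu> then 1 else 0)"
    using assms(2) sort_desc_partition[OF assms(2)]
    by (auto simp: coef_msym orbit_ind_def partitions_iff)
  ultimately show ?thesis by simp
qed

text \<open>Comparing coefficients gives A B = 1; for square matrices this implies B A = 1, the
  order in which the final block computation uses duality.\<close>

lemma B_mult_tmsym:
  assumes "N \<ge> 1" "\<mu> \<in> partitions N n" "\<nu> \<in> partitions N n"
  shows "(\<Sum>\<rho>\<in>partitions N n. B N \<mu> \<rho> * coef (tmsym N \<nu>) \<rho>) = (if \<mu> = \<nu> then 1 else 0)"
proof -
  obtain xs where xs: "distinct xs" "set xs = partitions N n"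
    using finite_distinct_list[OF finite_partitions] by metis
  let ?A = "lmat xs xs (\<lambda>\<mu> \<nu>. coef (tmsym N \<nu>) \<mu>)" and ?B = "lmat xs xs (B N)"
  have "?A * ?B = lmat xs xs (\<lambda>\<mu> \<nu>. if \<mu> = \<nu> then 1 else 0)"
    unfolding lmat_mult[OF xs(1)] by (rule lmat_cong) (simp add: xs(2) tmsym_mult_B[OF assms(1)])
  then have AB: "?A * ?B = 1\<^sub>m (length xs)" by (simp only: lmat_one[OF xs(1)])
  have "?B * ?A = 1\<^sub>m (length xs)"
    by (rule mat_mult_left_right_inverse[OF lmat_carrier lmat_carrier AB])
  then have eq: "lmat xs xs (\<lambda>\<mu> \<nu>. \<Sum>\<rho>\<in>set xs. B N \<mu> \<rho> * coef (tmsym N \<nu>) \<rho>) =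
      lmat xs xs (\<lambda>\<mu> \<nu>. if \<mu> = \<nu> then 1 else 0)"
    by (simp only: lmat_mult[OF xs(1)] lmat_one[OF xs(1)])
  obtain i j where ij: "i < length xs" "xs ! i = \<mu>" "j < length xs" "xs ! j = \<nu>"
    using assms(2,3) xs(2) by (metis in_set_conv_nth)
  then show ?thesis using arg_cong[OF eq, of "\<lambda>M. M $$ (i, j)"] by (simp add: xs(2))
qed

section \<open>Dunkl operators on coefficients\<close>

text \<open>\<open>\<D>\<^sub>i x\<^sup>\<alpha> = dunkl_factor \<kappa> (\<alpha>\<^sub>i - 1) x\<^bsup>\<alpha> - e\<^sub>i\<^esup>\<close>\<close>

definition dunkl_factor :: "real \<Rightarrow> nat \<Rightarrow> real" where
  "dunkl_factor \<kappa> k = real k + 1 + (if even k then 2 * \<kappa> else 0)"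

lemma coef_pderiv_var: "coef (pderiv_var i p) \<beta> = (real (coef \<beta> i) + 1) * coef p (inc i \<beta>)"
proof -
  have "coef (pderiv_var i p) \<beta> = (\<Sum>\<alpha>\<in>Poly_Mapping.keys p.
      if \<alpha> = inc i \<beta> then coef p \<alpha> * real (coef \<alpha> i) else 0)"
    unfolding pderiv_var_def lookup_sum
  proof (intro sum.cong refl)
    fix \<alpha> assume "\<alpha> \<in> Poly_Mapping.keys p"
    show "coef (cpoly (coef p \<alpha> * real (coef \<alpha> i)) * xpow (\<alpha> - Poly_Mapping.single i 1)) \<beta> =
        (if \<alpha> = inc i \<beta> then coef p \<alpha> * real (coef \<alpha> i) else 0)"
    proof (cases "coef \<alpha> i = 0")
      \<comment> \<open>Here truncated subtraction returns \<alpha> itself, but the factor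
        \<open>coef \<alpha> i\<close> is 0.\<close>
      case True
      then show ?thesis by (auto simp: coef_cpoly_mult coef_xpow coef_inc)
    next
      case False
      have "\<alpha> - Poly_Mapping.single i 1 = dec i \<alpha>"
        by (rule poly_mapping_eqI) (auto simp: lookup_minus lookup_single when_def coef_dec)
      moreover have "dec i \<alpha> = \<beta> \<longleftrightarrow> \<alpha> = inc i \<beta>" using False by auto
      ultimately show ?thesis by (simp add: coef_cpoly_mult coef_xpow)
    qed
  qed
  also have "\<dots> = (real (coef \<beta> i) + 1) * coef p (inc i \<beta>)"
    by (auto simp: coef_inc in_keys_iff)
  finally show ?thesis .
qed

lemma coef_subst_poly:
  "coef (subst_poly y p) \<beta> =
    (\<Sum>\<alpha>\<in>Poly_Mapping.keys p. coef p \<alpha> * coef (\<Prod>i\<in>Poly_Mapping.keys \<alpha>. y i ^ coef \<alpha> i) \<beta>)"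
  by (simp add: subst_poly_def lookup_sum coef_cpoly_mult)

lemma coef_reflect: "coef (reflect i p) \<beta> = (-1) ^ coef \<beta> i * coef p \<beta>"
proof -
  have *: "coef (\<Prod>j\<in>Poly_Mapping.keys \<alpha>. (if j = i then - X j else X j) ^ coef \<alpha> j) \<beta> =
      (if \<alpha> = \<beta> then (-1) ^ coef \<beta> i else 0)" for \<alpha>
  proof -
    have "(\<Prod>j\<in>Poly_Mapping.keys \<alpha>. (if j = i then - X j else X j) ^ coef \<alpha> j) =
        (\<Prod>j\<in>Poly_Mapping.keys \<alpha>. (if j = i then (-1) ^ coef \<alpha> j else 1) * X j ^ coef \<alpha> j)"
    proof (intro prod.cong refl)
      fix j
      show "(if j = i then - X j else X j) ^ coef \<alpha> j = (if j = i then (-1) ^ coef \<alpha> j else 1) * X j ^ coef \<alpha> j"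
        by (simp add: power_minus[of "X i"])
    qed
    also have "\<dots> = (-1) ^ coef \<alpha> i * xpow \<alpha>"
      by (simp add: prod.distrib xpow_eq_prod in_keys_iff)
    also have "coef \<dots> \<beta> = (if \<alpha> = \<beta> then (-1) ^ coef \<beta> i else 0)"
      by (cases "even (coef \<alpha> i)") (auto simp: coef_xpow)
    finally show ?thesis .
  qed
  have "coef (reflect i p) \<beta> = (\<Sum>\<alpha>\<in>Poly_Mapping.keys p. if \<alpha> = \<beta> then (-1) ^ coef \<beta> i * coef p \<alpha> else 0)"
    unfolding reflect_def coef_subst_poly * by (intro sum.cong) auto
  then show ?thesis by (auto simp: in_keys_iff)
qed

lemma coef_dunkl: "coef (dunkl \<kappa> i f) \<alpha> = dunkl_factor \<kappa> (coef \<alpha> i) * coef f (inc i \<alpha>)"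
proof -
  define q where "q = (THE q. X i * q = f - reflect i f)"
  have q: "X i * q = f - reflect i f"
    unfolding q_def by (rule theI'[OF ex1_dunkl_quotient])
  \<comment> \<open>Only the product of \<open>X i\<close> with the quotient is known; raising the
    index by one at i turns its coefficients into those of the quotient.\<close>
  have "coef q \<alpha> = coef (X i * q) (inc i \<alpha>)" by (simp add: coef_X_mult coef_inc)
  also have "\<dots> = (1 - (-1) ^ Suc (coef \<alpha> i)) * coef f (inc i \<alpha>)"
    unfolding q by (simp add: lookup_minus coef_reflect coef_inc algebra_simps)
  finally have "coef q \<alpha> = (if even (coef \<alpha> i) then 2 else 0) * coef f (inc i \<alpha>)" by simp
  moreover have "dunkl \<kappa> i f = pderiv_var i f + cpoly \<kappa> * q" by (simp only: dunkl_def q_def)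
  ultimately show ?thesis
    by (simp add: lookup_add coef_pderiv_var coef_cpoly_mult dunkl_factor_def, simp add: algebra_simps)
qed

lemma coef_dunkl_funpow:
  "coef ((dunkl \<kappa> i ^^ k) f) \<alpha> =
    (\<Prod>j<k. dunkl_factor \<kappa> (coef \<alpha> i + j)) * coef f (\<alpha> + Poly_Mapping.single i k)"
proof (induction k arbitrary: \<alpha>)
  case (Suc k)
  have eq: "inc i \<alpha> + Poly_Mapping.single i k = \<alpha> + Poly_Mapping.single i (Suc k)"
    by (rule poly_mapping_eqI) (simp add: coef_inc lookup_add lookup_single when_def)
  show ?case
    by (simp add: coef_dunkl Suc.IH eq prod.lessThan_Suc_shift coef_inc mult.assoc del: prod.lessThan_Suc)
qed simp

text \<open>Each operator changes only its own variable, so its factors start at entry 0 of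
  \<gamma>. The index \<gamma> is general because the preceding operators have already shifted it at
  their own, different, positions.\<close>

lemma coef_dunkl_power_list:
  assumes "distinct xs" "\<And>i. i \<in> set xs \<Longrightarrow> coef \<gamma> i = 0"
  shows "coef (foldr (\<lambda>i T. (dunkl \<kappa> i ^^ coef \<alpha> i) \<circ> T) xs id g) \<gamma> =
    (\<Prod>i\<in>set xs. \<Prod>j<coef \<alpha> i. dunkl_factor \<kappa> j) *
    coef g (\<gamma> + (\<Sum>i\<in>set xs. Poly_Mapping.single i (coef \<alpha> i)))"
  using assms
proof (induction xs arbitrary: \<gamma>)
  case (Cons i xs)
  have "coef (\<gamma> + Poly_Mapping.single i (coef \<alpha> i)) j = 0" if "j \<in> set xs" for j
    using Cons.prems that by (auto simp: lookup_add lookup_single when_def)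
  with Cons show ?case by (simp add: coef_dunkl_funpow add.assoc mult.assoc)
qed simp

lemma eval_poly_0: "eval_poly (\<lambda>_. 0) p = coef p 0"
proof -
  have "(\<Prod>i\<in>Poly_Mapping.keys \<alpha>. (0::real) ^ coef \<alpha> i) = (if \<alpha> = 0 then 1 else 0)" for \<alpha> :: mindex
  proof (cases "\<alpha> = 0")
    case False
    then obtain i where "i \<in> Poly_Mapping.keys \<alpha>" by (metis all_not_in_conv keys_eq_empty)
    then show ?thesis using False by (auto simp: in_keys_iff intro!: prod_zero)
  qed simp
  then show ?thesis by (simp add: eval_poly_def in_keys_iff if_distrib[of "(*) _"] cong: if_cong)
qed

definition dunkl_norm :: "nat \<Rightarrow> real \<Rightarrow> mindex \<Rightarrow> real" where
  "dunkl_norm N \<kappa> \<alpha> = (\<Prod>i<N. \<Prod>j<coef \<alpha> i. dunkl_factor \<kappa> j)"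

text \<open>Applying the operators of exponent \<alpha> and evaluating at 0 extracts the coefficient
  at \<alpha>, so monomials are orthogonal. The set \<open>K\<close> is any finite set containing
  the support of f, so it can be chosen as a union of doubled orbits.\<close>

lemma inner_h_eq_sum:
  assumes "finite K" "K \<subseteq> mindices N" "Poly_Mapping.keys f \<subseteq> K"
  shows "inner_h N \<kappa> f g = (\<Sum>\<alpha>\<in>K. dunkl_norm N \<kappa> \<alpha> * coef f \<alpha> * coef g \<alpha>)"
proof -
  have *: "coef (dunkl_power N \<kappa> \<alpha> g) 0 = dunkl_norm N \<kappa> \<alpha> * coef g \<alpha>" if "\<alpha> \<in> mindices N" for \<alpha>
  proof -
    have "(\<Sum>i<N. Poly_Mapping.single i (coef \<alpha> i)) = \<alpha>"
    proof (rule mindices_eqI[of _ N])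
      show "(\<Sum>i<N. Poly_Mapping.single i (coef \<alpha> i)) \<in> mindices N"
        by (rule mindicesI) (simp add: lookup_sum lookup_single)
    qed (use that in \<open>simp_all add: lookup_sum lookup_single when_def\<close>)
    then show ?thesis
      using coef_dunkl_power_list[where xs = "[0..<N]" and \<gamma> = 0 and \<kappa> = \<kappa> and \<alpha> = \<alpha> and g = g]
      by (simp add: dunkl_power_def dunkl_norm_def lessThan_atLeast0)
  qed
  have "inner_h N \<kappa> f g = (\<Sum>\<alpha>\<in>Poly_Mapping.keys f. coef f \<alpha> * coef (dunkl_power N \<kappa> \<alpha> g) 0)"
    by (simp add: inner_h_def eval_poly_0 dunkl_apply_def lookup_sum coef_cpoly_mult)
  also have "\<dots> = (\<Sum>\<alpha>\<in>Poly_Mapping.keys f. dunkl_norm N \<kappa> \<alpha> * coef f \<alpha> * coef g \<alpha>)"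
    using assms * by (intro sum.cong refl) (auto simp: subset_iff)
  also have "\<dots> = (\<Sum>\<alpha>\<in>K. dunkl_norm N \<kappa> \<alpha> * coef f \<alpha> * coef g \<alpha>)"
    using assms by (intro sum.mono_neutral_left) (auto simp: in_keys_iff)
  finally show ?thesis .
qed

text \<open>Consecutive factors combine: (2k + 1 + 2\<kappa>)(2k + 2) = 4 (k + 1)(\<kappa> + 1/2 +
  k).\<close>

lemma prod_dunkl_factor_even:
  "(\<Prod>j<2 * k. dunkl_factor \<kappa> j) = 4 ^ k * (fact k * pochhammer (\<kappa> + 1/2) k)"
  by (induction k) (simp_all add: dunkl_factor_def pochhammer_Suc field_simps)

lemma dunkl_norm_double:
  assumes "\<alpha> \<in> mindices N"
  shows "dunkl_norm N \<kappa> (\<alpha> + \<alpha>) = 4 ^ weight \<alpha> * mweight N \<kappa> \<alpha>"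
proof -
  have "dunkl_norm N \<kappa> (\<alpha> + \<alpha>) = (\<Prod>i<N. 4 ^ coef \<alpha> i * (fact (coef \<alpha> i) * pochhammer (\<kappa> + 1/2) (coef \<alpha> i)))"
    unfolding dunkl_norm_def prod_dunkl_factor_even[symmetric] by (simp add: lookup_add mult_2)
  then show ?thesis
    by (simp add: prod.distrib mweight_def weight_eq_sum[OF assms] power_sum)
qed

section \<open>Polynomials in squared variables and the inner products of the
  \<open>h\<close>\<close>

lemma double_mindex_eq_iff [simp]: "\<alpha> + \<alpha> = \<beta> + \<beta> \<longleftrightarrow> \<alpha> = (\<beta> :: mindex)"
proof
  assume eq: "\<alpha> + \<alpha> = \<beta> + \<beta>"
  show "\<alpha> = \<beta>"
    by (rule poly_mapping_eqI) (use eq in \<open>metis lookup_add mult_2 nat_mult_eq_cancel1 zero_less_numeral\<close>)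
qed simp

lemma coef_subst_square:
  "coef (subst_poly (\<lambda>i. (X i)\<^sup>2) p) \<beta> =
    (\<Sum>\<alpha>\<in>Poly_Mapping.keys p. if \<alpha> + \<alpha> = \<beta> then coef p \<alpha> else 0)"
proof -
  have "(\<Prod>i\<in>Poly_Mapping.keys \<alpha>. (X i)\<^sup>2 ^ coef \<alpha> i) = xpow \<alpha> * xpow \<alpha>" for \<alpha>
    unfolding xpow_eq_prod prod.distrib[symmetric]
    by (intro prod.cong refl) (simp add: power2_eq_square power_mult_distrib)
  also have "xpow \<alpha> * xpow \<alpha> = xpow (\<alpha> + \<alpha>)" for \<alpha> by (simp add: xpow_def mult_single)
  finally show ?thesis unfolding coef_subst_poly by (intro sum.cong) (auto simp: coef_xpow)
qed

lemma coef_subst_square_double: "coef (subst_poly (\<lambda>i. (X i)\<^sup>2) p) (\<alpha> + \<alpha>) = coef p \<alpha>"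
  unfolding coef_subst_square by (simp add: in_keys_iff)

lemma keys_subst_square:
  "Poly_Mapping.keys (subst_poly (\<lambda>i. (X i)\<^sup>2) p) \<subseteq> (\<lambda>\<alpha>. \<alpha> + \<alpha>) ` Poly_Mapping.keys p"
proof
  fix \<beta> assume "\<beta> \<in> Poly_Mapping.keys (subst_poly (\<lambda>i. (X i)\<^sup>2) p)"
  then have "(\<Sum>\<alpha>\<in>Poly_Mapping.keys p. if \<alpha> + \<alpha> = \<beta> then coef p \<alpha> else 0) \<noteq> 0"
    by (simp add: in_keys_iff coef_subst_square)
  then obtain \<alpha> where "\<alpha> \<in> Poly_Mapping.keys p" "(if \<alpha> + \<alpha> = \<beta> then coef p \<alpha> else 0) \<noteq> 0"
    by (rule sum.not_neutral_contains_not_neutral)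
  then show "\<beta> \<in> (\<lambda>\<alpha>. \<alpha> + \<alpha>) ` Poly_Mapping.keys p" by (auto split: if_splits)
qed

lemma keys_msym: "Poly_Mapping.keys (msym N \<nu>) = orbit N \<nu>"
  by (auto simp: in_keys_iff coef_msym orbit_def orbit_ind_def split: if_splits)

lemma orbit_norm_eq:
  assumes "\<nu> \<in> mindices N"
  shows "real (mfact \<nu>) * mpochhammer (\<kappa> + 1/2) \<nu> * eval_poly (\<lambda>_. 1) (msym N \<nu>) = orbit_norm N \<kappa> \<nu>"
proof -
  have sub: "Poly_Mapping.keys \<nu> \<subseteq> {..<N}" using assms by (simp add: mindices_def)
  have "real (mfact \<nu>) = (\<Prod>i<N. fact (coef \<nu> i))"
    unfolding mfact_def of_nat_prod using sub
    by (intro prod.mono_neutral_cong_left) (auto simp: in_keys_iff)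
  moreover have "mpochhammer (\<kappa> + 1/2) \<nu> = (\<Prod>i<N. pochhammer (\<kappa> + 1/2) (coef \<nu> i))"
    unfolding mpochhammer_def using sub by (intro prod.mono_neutral_left) (auto simp: in_keys_iff)
  moreover have "eval_poly (\<lambda>_. 1) (msym N \<nu>) = real (card (orbit N \<nu>))"
    unfolding eval_poly_def keys_msym by (simp add: coef_msym orbit_def orbit_ind_def)
  ultimately show ?thesis by (simp add: orbit_norm_def mweight_def prod.distrib)
qed

lemma D_eq: "D N \<kappa> k = inverse (\<Prod>\<nu>\<in>partitions N k. orbit_norm N \<kappa> \<nu>)"
  unfolding D_def prod_inversef[symmetric] o_def
  by (intro prod.cong) (simp_all add: orbit_norm_eq partitions_iff)

lemma coef_h_double:
  assumes N: "N \<ge> 1" and \<mu>: "\<mu> \<in> partitions N n" and \<nu>: "\<nu> \<in> partitions N n" and \<alpha>: "\<alpha> \<in> orbit N \<nu>"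
  shows "coef (h N \<kappa> \<mu>) (\<alpha> + \<alpha>) = B N \<mu> \<nu> / orbit_norm N \<kappa> \<nu> / 2 ^ n"
proof -
  have w: "weight \<mu> = n" using \<mu> by (simp add: partitions_iff)
  have s: "\<alpha> \<in> mindices N" "sort_desc N \<alpha> = \<nu>" using \<alpha> by (auto simp: orbit_def)
  let ?S = "{\<nu>. \<nu> \<in> partitions N n \<and> prec \<mu> \<nu>}"
  have fin: "finite ?S" using finite_partitions by simp
  have "coef (h N \<kappa> \<mu>) (\<alpha> + \<alpha>) =
      (\<Sum>\<rho>\<in>?S. (if \<nu> = \<rho> then 1 else 0) * (B N \<mu> \<rho> / orbit_norm N \<kappa> \<rho>)) / 2 ^ n"
    unfolding h_def coef_cpoly_mult lookup_sum coef_subst_square_double w coef_msym orbit_ind_def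
    by (simp add: s) (intro sum.cong refl, simp add: orbit_norm_eq[symmetric] partitions_iff)
  also have "\<dots> = B N \<mu> \<nu> / orbit_norm N \<kappa> \<nu> / 2 ^ n"
    \<comment> \<open>If \<nu> lies outside the range of the sum in \<open>h\<close>, then
      \<open>prec \<mu> \<nu>\<close> fails and \<open>B N \<mu> \<nu>\<close> is 0, so the formula
      still holds.\<close>
    unfolding sum_delta_mult_left[OF fin] using B_coordinates(1)[OF N \<nu>, of \<mu>] \<nu> by auto
  finally show ?thesis .
qed

lemma keys_cpoly_mult: "Poly_Mapping.keys (cpoly c * p) \<subseteq> Poly_Mapping.keys p"
  by (auto simp: in_keys_iff coef_cpoly_mult)

lemma keys_sum_subset: "(\<And>a. a \<in> A \<Longrightarrow> Poly_Mapping.keys (f a) \<subseteq> K) \<Longrightarrow> Poly_Mapping.keys (sum f A) \<subseteq> K"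
proof (induction A rule: infinite_finite_induct)
  case (insert a A)
  then show ?case using keys_add[of "f a" "sum f A"] by auto
qed simp_all

lemma keys_h:
  assumes "\<mu> \<in> partitions N n"
  shows "Poly_Mapping.keys (h N \<kappa> \<mu>) \<subseteq> (\<lambda>\<alpha>. \<alpha> + \<alpha>) ` (\<Union>\<nu>\<in>partitions N n. orbit N \<nu>)"
proof -
  have w: "weight \<mu> = n" using assms by (simp add: partitions_iff)
  have *: "Poly_Mapping.keys (cpoly c * subst_poly (\<lambda>i. (X i)\<^sup>2) (msym N \<nu>)) \<subseteq>
      (\<lambda>\<alpha>. \<alpha> + \<alpha>) ` (\<Union>\<nu>\<in>partitions N n. orbit N \<nu>)" if "\<nu> \<in> partitions N n" for \<nu> c
    using keys_cpoly_mult[of c "subst_poly (\<lambda>i. (X i)\<^sup>2) (msym N \<nu>)"] keys_subst_square[of "msym N \<nu>"] that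
    unfolding keys_msym by fast
  show ?thesis
    unfolding h_def w by (rule order_trans[OF keys_cpoly_mult], intro keys_sum_subset, rule *) simp
qed

lemma inner_h_h:
  assumes N: "N \<ge> 1" and \<kappa>: "\<kappa> \<ge> 0" and \<mu>: "\<mu> \<in> partitions N n" and \<rho>: "\<rho> \<in> partitions N n"
  shows "inner_h N \<kappa> (h N \<kappa> \<mu>) (h N \<kappa> \<rho>) =
    (\<Sum>\<nu>\<in>partitions N n. B N \<mu> \<nu> * B N \<rho> \<nu> / orbit_norm N \<kappa> \<nu>)"
proof -
  let ?O = "\<Union>\<nu>\<in>partitions N n. orbit N \<nu>" and ?dbl = "\<lambda>\<alpha> :: mindex. \<alpha> + \<alpha>"
  let ?F = "\<lambda>\<alpha>. dunkl_norm N \<kappa> \<alpha> * coef (h N \<kappa> \<mu>) \<alpha> * coef (h N \<kappa> \<rho>) \<alpha>"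
  have "finite ?O" by (intro finite_UN_I finite_partitions finite_orbit)
  moreover have "?dbl ` ?O \<subseteq> mindices N"
    by (auto simp: orbit_def intro!: mindicesI simp: lookup_add coef_mindices_eq_0)
  ultimately have "inner_h N \<kappa> (h N \<kappa> \<mu>) (h N \<kappa> \<rho>) = (\<Sum>\<alpha>\<in>?dbl ` ?O. ?F \<alpha>)"
    using keys_h[OF \<mu>] by (intro inner_h_eq_sum) auto
  also have "\<dots> = (\<Sum>\<alpha>\<in>?O. ?F (\<alpha> + \<alpha>))"
    by (subst sum.reindex) (auto simp: inj_on_def)
  also have "\<dots> = (\<Sum>\<nu>\<in>partitions N n. \<Sum>\<alpha>\<in>orbit N \<nu>. ?F (\<alpha> + \<alpha>))"
    by (intro sum.UNION_disjoint) (simp_all add: finite_partitions finite_orbit, auto simp: orbit_def)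
  also have "\<dots> = (\<Sum>\<nu>\<in>partitions N n. B N \<mu> \<nu> * B N \<rho> \<nu> / orbit_norm N \<kappa> \<nu>)"
  proof (intro sum.cong refl)
    fix \<nu> assume \<nu>: "\<nu> \<in> partitions N n"
    let ?c = "orbit_norm N \<kappa> \<nu>" and ?b = "B N \<mu> \<nu> * B N \<rho> \<nu>"
    have c: "?c > 0" by (rule orbit_norm_pos[OF \<kappa> \<nu>])
    have "?F (\<alpha> + \<alpha>) = mweight N \<kappa> \<alpha> * (?b / (?c * ?c))" if \<alpha>: "\<alpha> \<in> orbit N \<nu>" for \<alpha>
    proof -
      have m: "\<alpha> \<in> mindices N" and s: "sort_desc N \<alpha> = \<nu>" using \<alpha> by (auto simp: orbit_def)
      have w: "weight \<alpha> = n" using weight_sort_desc[OF m] s \<nu> by (simp add: partitions_iff)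
      \<comment> \<open>The power of 4 from the norm of a doubled monomial cancels the normalising
        powers of 2 of the two \<open>h\<close>.\<close>
      have "(4::real) ^ n = 2 ^ n * 2 ^ n" by (simp flip: power_mult_distrib)
      then show ?thesis
        unfolding coef_h_double[OF N \<mu> \<nu> \<alpha>] coef_h_double[OF N \<rho> \<nu> \<alpha>] dunkl_norm_double[OF m] w
        by simp
    qed
    then have "(\<Sum>\<alpha>\<in>orbit N \<nu>. ?F (\<alpha> + \<alpha>)) = (\<Sum>\<alpha>\<in>orbit N \<nu>. mweight N \<kappa> \<alpha> * (?b / (?c * ?c)))"
      by (rule sum.cong[OF refl])
    also have "\<dots> = ?c * (?b / (?c * ?c))"
      using \<nu> by (intro orbit_norm_sum) (simp_all add: symmetric_coefs_def partitions_iff)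
    also have "\<dots> = ?b / ?c" using c by simp
    finally show "(\<Sum>\<alpha>\<in>orbit N \<nu>. ?F (\<alpha> + \<alpha>)) = ?b / ?c" .
  qed
  finally show ?thesis .
qed

section \<open>Determinants\<close>

lemma det_tmsym:
  assumes "N \<ge> 1" "distinct xs" "set xs = partitions N n"
  shows "det (lmat xs xs (\<lambda>\<nu> \<mu>. coef (tmsym N \<mu>) \<nu>)) = 1"
  using assms tmsym_diagonal[OF assms(1)] tmsym_strictly_triangular[OF assms(1)]
  by (intro det_lmat_unitriangular[where r = "\<lambda>\<nu>. coef \<nu> 0"]) auto

lemma orbit_ind_partition:
  "\<nu> \<in> partitions N n \<Longrightarrow> orbit_ind N \<mu> \<nu> = (if \<nu> = \<mu> then 1 else 0)"
  by (simp add: orbit_ind_def)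

text \<open>Matrix form of the composite on degree n: both factors are expanded in the monomial
  basis, the sums exchanged, and the inner sum collapsed back to the composite.\<close>

lemma lowering_raising_expand:
  assumes f: "symmetric_coefs N f" and \<nu>: "\<nu> \<in> partitions N n"
  shows "lowering N \<kappa> (raising N f) \<nu> =
    (\<Sum>\<rho>\<in>partitions N n. lowering N \<kappa> (raising N (orbit_ind N \<rho>)) \<nu> * f \<rho>)"
proof -
  have *: "\<rho> \<in> mindices N" "weight \<rho> = m" if "\<rho> \<in> partitions N m" for \<rho> m
    using that by (auto simp: partitions_iff)
  let ?L = "\<lambda>\<mu>. lowering N \<kappa> (orbit_ind N \<mu>) \<nu>" and ?R = "\<lambda>\<mu> \<rho>. raising N (orbit_ind N \<rho>) \<mu>"
  have "lowering N \<kappa> (raising N f) \<nu> = (\<Sum>\<mu>\<in>partitions N (Suc n). ?L \<mu> * raising N f \<mu>)"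
    using f *[OF \<nu>] by (intro lowering_expand symmetric_raising)
  also have "\<dots> = (\<Sum>\<mu>\<in>partitions N (Suc n). \<Sum>\<rho>\<in>partitions N n. ?L \<mu> * ?R \<mu> \<rho> * f \<rho>)"
    using * by (intro sum.cong refl) (simp add: raising_expand[OF f] sum_distrib_left mult.assoc)
  also have "\<dots> = (\<Sum>\<rho>\<in>partitions N n. (\<Sum>\<mu>\<in>partitions N (Suc n). ?L \<mu> * ?R \<mu> \<rho>) * f \<rho>)"
    by (subst sum.swap) (simp add: sum_distrib_right)
  also have "\<dots> = (\<Sum>\<rho>\<in>partitions N n. lowering N \<kappa> (raising N (orbit_ind N \<rho>)) \<nu> * f \<rho>)"
    using *[OF \<nu>] by (intro sum.cong refl arg_cong2[of _ _ _ _ "(*)"] lowering_expand[symmetric]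
      symmetric_raising symmetric_orbit_ind)
  finally show ?thesis .
qed

text \<open>The constant \<open>c\<close> is the shift accumulated in higher degrees; it must be
  general for the induction, since each use of Sylvester's identity adds the commutator scalar of
  the current degree. Its nonnegativity keeps the shift positive and hence cancellable.\<close>

lemma det_lowering_raising:
  assumes N: "N \<ge> 1" and \<kappa>: "\<kappa> \<ge> 0"
    and "distinct xs" "set xs = partitions N n" "c \<ge> 0"
  shows "det (lmat xs xs (\<lambda>\<nu> \<mu>. lowering N \<kappa> (raising N (orbit_ind N \<mu>)) \<nu> + (if \<nu> = \<mu> then c else 0))) =
    (\<Prod>i<Suc n. (c + (real i + 1) * (2 * real n - real i + real N * (\<kappa> + 1/2))) ^ d (n - i) N)"
  using assms(3-5)
proof (induction n arbitrary: xs c)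
  case 0
  then have xs: "xs = [0]" by (auto simp: partitions_0 dest: distinct_card)
    (metis card.empty card_insert_disjoint distinct_card empty_iff finite.emptyI length_0_conv length_Suc_conv list.set_intros(1) singletonD)
  have m: "(0::mindex) \<in> mindices N" by (simp add: mindices_def)
  \<comment> \<open>There is nothing below degree 0, so of the commutation relation only the scalar
    remains.\<close>
  have "lowering N \<kappa> (raising N (orbit_ind N 0)) 0 = real N * (\<kappa> + 1/2)"
    unfolding lowering_raising[OF m]
    by (simp add: raising_def orbit_ind_partition[of 0 N 0] partitions_0 weight_def)
  then show ?case by (simp add: xs lmat_def det_single d_0)
next
  case (Suc n)
  define a where "a = real N * (\<kappa> + 1/2)"
  \<comment> \<open>The old shift plus the commutator scalar of degree n + 1.\<close>
  define t where "t = c + (a + 2 * real (Suc n))"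
  obtain ys where ys: "distinct ys" "set ys = partitions N n"
    using finite_distinct_list[OF finite_partitions] by metis
  have a: "a \<ge> 0" using \<kappa> by (simp add: a_def)
  then have t: "t > 0" using Suc.prems(3) by (simp add: t_def)
  have *: "\<rho> \<in> mindices N" "weight \<rho> = m" if "\<rho> \<in> partitions N m" for \<rho> m
    using that by (auto simp: partitions_iff)
  let ?M = "\<lambda>\<nu> \<mu>. lowering N \<kappa> (raising N (orbit_ind N \<mu>)) \<nu>"
  let ?U = "lmat xs ys (\<lambda>\<nu> \<rho>. raising N (orbit_ind N \<rho>) \<nu>)"
  let ?V = "lmat ys xs (\<lambda>\<rho> \<mu>. lowering N \<kappa> (orbit_ind N \<mu>) \<rho>)"
  have "t \<cdot>\<^sub>m 1\<^sub>m (length xs) + ?U * ?V = lmat xs xs (\<lambda>\<nu> \<mu>. ?M \<nu> \<mu> + (if \<nu> = \<mu> then c else 0))"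
    unfolding smult_one_lmat[OF Suc.prems(1)] lmat_mult[OF ys(1)] lmat_add
  proof (rule lmat_cong)
    fix \<nu> \<mu> assume \<nu>: "\<nu> \<in> set xs" and \<mu>: "\<mu> \<in> set xs"
    have \<nu>': "\<nu> \<in> partitions N (Suc n)" using \<nu> Suc.prems(2) by simp
    have "(\<Sum>\<rho>\<in>set ys. raising N (orbit_ind N \<rho>) \<nu> * lowering N \<kappa> (orbit_ind N \<mu>) \<rho>) =
        raising N (lowering N \<kappa> (orbit_ind N \<mu>)) \<nu>"
      unfolding ys(2) using *[OF \<nu>']
      by (intro raising_expand[symmetric] symmetric_lowering symmetric_orbit_ind)
    then show "(if \<nu> = \<mu> then t else 0) +
        (\<Sum>\<rho>\<in>set ys. raising N (orbit_ind N \<rho>) \<nu> * lowering N \<kappa> (orbit_ind N \<mu>) \<rho>) =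
        ?M \<nu> \<mu> + (if \<nu> = \<mu> then c else 0)"
      unfolding lowering_raising[OF *(1)[OF \<nu>']] *(2)[OF \<nu>'] orbit_ind_partition[OF \<nu>']
      by (simp add: t_def a_def)
  qed
  moreover have "t \<cdot>\<^sub>m 1\<^sub>m (length ys) + ?V * ?U = lmat ys ys (\<lambda>\<nu> \<mu>. ?M \<nu> \<mu> + (if \<nu> = \<mu> then t else 0))"
    unfolding smult_one_lmat[OF ys(1)] lmat_mult[OF Suc.prems(1)] lmat_add
  proof (rule lmat_cong)
    fix \<nu> \<mu> assume "\<nu> \<in> set ys" "\<mu> \<in> set ys"
    then have \<nu>': "\<nu> \<in> partitions N n" using ys(2) by simp
    have "(\<Sum>\<rho>\<in>set xs. lowering N \<kappa> (orbit_ind N \<rho>) \<nu> * raising N (orbit_ind N \<mu>) \<rho>) = ?M \<nu> \<mu>"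
      unfolding Suc.prems(2) using *[OF \<nu>']
      by (intro lowering_expand[symmetric] symmetric_raising symmetric_orbit_ind)
    then show "(if \<nu> = \<mu> then t else 0) +
        (\<Sum>\<rho>\<in>set xs. lowering N \<kappa> (orbit_ind N \<rho>) \<nu> * raising N (orbit_ind N \<mu>) \<rho>) =
        ?M \<nu> \<mu> + (if \<nu> = \<mu> then t else 0)" by simp
  qed
  ultimately have syl: "t ^ length ys * det (lmat xs xs (\<lambda>\<nu> \<mu>. ?M \<nu> \<mu> + (if \<nu> = \<mu> then c else 0))) =
      t ^ length xs * det (lmat ys ys (\<lambda>\<nu> \<mu>. ?M \<nu> \<mu> + (if \<nu> = \<mu> then t else 0)))"
    using det_sylvester[OF lmat_carrier lmat_carrier, of t xs ys _ _] by metis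
  have "length xs = d (Suc n) N + length ys"
    using card_partitions_Suc[OF N, of n] distinct_card[OF Suc.prems(1)] distinct_card[OF ys(1)]
      Suc.prems(2) ys(2) by simp
  \<comment> \<open>Cancelling \<open>t ^ length ys\<close> leaves the dimension difference as
    exponent.\<close>
  then have "det (lmat xs xs (\<lambda>\<nu> \<mu>. ?M \<nu> \<mu> + (if \<nu> = \<mu> then c else 0))) =
      t ^ d (Suc n) N * det (lmat ys ys (\<lambda>\<nu> \<mu>. ?M \<nu> \<mu> + (if \<nu> = \<mu> then t else 0)))"
    using syl t by (simp add: power_add)
  also have "\<dots> = t ^ d (Suc n) N *
      (\<Prod>i<Suc n. (t + (real i + 1) * (2 * real n - real i + a)) ^ d (n - i) N)"
    using Suc.IH[OF ys, of t] t by (simp add: a_def)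
  also have "\<dots> = (\<Prod>i<Suc (Suc n).
      (c + (real i + 1) * (2 * real (Suc n) - real i + a)) ^ d (Suc n - i) N)"
    unfolding prod.lessThan_Suc_shift[of _ "Suc n"]
  proof (intro arg_cong2[of _ _ _ _ "(*)"] prod.cong refl)
    show "t ^ d (Suc n) N = (c + (real 0 + 1) * (2 * real (Suc n) - real 0 + a)) ^ d (Suc n - 0) N"
      by (simp add: t_def algebra_simps)
    show "(t + (real i + 1) * (2 * real n - real i + a)) ^ d (n - i) N =
        (c + (real (Suc i) + 1) * (2 * real (Suc n) - real (Suc i) + a)) ^ d (Suc n - Suc i) N" for i
    proof -
      \<comment> \<open>The term (i + 1)(2n - i + a) is the sum of the commutator scalars of degrees
        n, ..., n - i; adding that of degree n + 1 gives the corresponding sum starting one degree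
        higher.\<close>
      have "t + (real i + 1) * (2 * real n - real i + a) =
          c + (real (Suc i) + 1) * (2 * real (Suc n) - real (Suc i) + a)"
        by (simp add: t_def algebra_simps)
      then show ?thesis by simp
    qed
  qed
  finally show ?case by (simp add: a_def)
qed

text \<open>Adjointness moves one factor e1 across the pairing, so the Gram matrix becomes A^T (C M)
  A in degree n, with M the matrix of \<open>lowering\<close> after \<open>raising\<close>. The
  outer factors have determinant 1, and C contributes the product of norms.\<close>

lemma det_raised_gram:
  assumes N: "N \<ge> 1" and ys: "distinct ys" "set ys = partitions N n"
  shows "det (lmat ys ys (\<lambda>\<mu> \<rho>. \<Sum>\<nu>\<in>partitions N (Suc n).
      coef (tmsym N (inc 0 \<mu>)) \<nu> * orbit_norm N \<kappa> \<nu> * coef (tmsym N (inc 0 \<rho>)) \<nu>)) =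
    (\<Prod>\<nu>\<in>partitions N n. orbit_norm N \<kappa> \<nu>) *
    det (lmat ys ys (\<lambda>\<nu> \<mu>. lowering N \<kappa> (raising N (orbit_ind N \<mu>)) \<nu>))"
proof -
  let ?A = "\<lambda>\<nu> \<mu>. coef (tmsym N \<mu>) \<nu>" and ?c = "orbit_norm N \<kappa>"
  let ?M = "\<lambda>\<nu> \<mu>. lowering N \<kappa> (raising N (orbit_ind N \<mu>)) \<nu>"
  have *: "\<rho> \<in> mindices N" "weight \<rho> = m" if "\<rho> \<in> partitions N m" for \<rho> m
    using that by (auto simp: partitions_iff)
  have "lmat ys ys (\<lambda>\<mu> \<rho>. \<Sum>\<nu>\<in>partitions N (Suc n). ?A \<nu> (inc 0 \<mu>) * ?c \<nu> * ?A \<nu> (inc 0 \<rho>)) =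
      lmat ys ys (\<lambda>\<mu> \<rho>. \<Sum>\<nu>\<in>set ys. ?A \<nu> \<mu> * (\<Sum>\<sigma>\<in>set ys. (?c \<nu> * ?M \<nu> \<sigma>) * ?A \<sigma> \<rho>))"
  proof (rule lmat_cong)
    fix \<mu> \<rho> assume "\<mu> \<in> set ys" "\<rho> \<in> set ys"
    then have \<mu>: "\<mu> \<in> partitions N n" and \<rho>: "\<rho> \<in> partitions N n" using ys(2) by auto
    have sym: "symmetric_coefs N (coef (tmsym N \<mu>))" "symmetric_coefs N (coef (tmsym N \<rho>))"
      using symmetric_tmsym[OF N] \<mu> \<rho> by blast+
    let ?r = "raising N (coef (tmsym N \<rho>))"
    have "(\<Sum>\<nu>\<in>partitions N (Suc n). ?A \<nu> (inc 0 \<mu>) * ?c \<nu> * ?A \<nu> (inc 0 \<rho>)) =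
        (\<Sum>\<nu>\<in>partitions N (Suc n). \<Sum>\<sigma>\<in>partitions N n.
          ?A \<sigma> \<mu> * (?c \<nu> * raising N (orbit_ind N \<sigma>) \<nu>) * ?r \<nu>)"
      using * by (intro sum.cong refl)
        (simp add: tmsym_inc[OF \<mu>] tmsym_inc[OF \<rho>] coef_e1_mult raising_expand[OF sym(1)]
          sum_distrib_left sum_distrib_right mult_ac)
    \<comment> \<open>\<open>raising_adjoint\<close> is applied to the monomial basis elements,
      after expanding only the left argument.\<close>
    also have "\<dots> = (\<Sum>\<sigma>\<in>partitions N n. \<Sum>\<nu>\<in>partitions N (Suc n).
          ?A \<sigma> \<mu> * (?c \<sigma> * lowering N \<kappa> (orbit_ind N \<nu>) \<sigma>) * ?r \<nu>)"
      using * by (subst sum.swap) (simp add: raising_adjoint)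
    also have "\<dots> = (\<Sum>\<sigma>\<in>partitions N n. ?A \<sigma> \<mu> * (?c \<sigma> * lowering N \<kappa> ?r \<sigma>))"
      using * by (intro sum.cong refl)
        (simp add: lowering_expand[OF symmetric_raising[OF sym(2)]] sum_distrib_left mult_ac)
    also have "\<dots> = (\<Sum>\<nu>\<in>set ys. ?A \<nu> \<mu> * (\<Sum>\<sigma>\<in>set ys. (?c \<nu> * ?M \<nu> \<sigma>) * ?A \<sigma> \<rho>))"
      by (simp add: ys(2) lowering_raising_expand[OF sym(2)] sum_distrib_left mult_ac)
    finally show "(\<Sum>\<nu>\<in>partitions N (Suc n). ?A \<nu> (inc 0 \<mu>) * ?c \<nu> * ?A \<nu> (inc 0 \<rho>)) =
        (\<Sum>\<nu>\<in>set ys. ?A \<nu> \<mu> * (\<Sum>\<sigma>\<in>set ys. (?c \<nu> * ?M \<nu> \<sigma>) * ?A \<sigma> \<rho>))" .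
  qed
  then show ?thesis
    by (simp only: det_lmat_mult[OF ys(1)] det_lmat_transpose[of ys ?A] det_lmat_scale_rows[OF ys(1)]
        det_tmsym[OF N ys]) (simp only: ys(2) mult_1_left mult_1_right)
qed

theorem theorem3:
  fixes N n :: nat and \<kappa> :: real and ps :: "mindex list"
  assumes "N \<ge> 1" and "n \<ge> 1" and "\<kappa> \<ge> 0"
    and "distinct ps" and "set ps = tpartitions N n"
  shows "det (gram_matrix (inner_h N \<kappa>) (map (h N \<kappa>) ps)) =
    D N \<kappa> n / D N \<kappa> (n - 1) *
    (\<Prod>i=1..n. (real i * (2 * real n - real i - 1 + real N / 2 + real N * \<kappa>)) ^ d (n - i) N)"
proof -
  obtain m where n: "n = Suc m" using assms(2) by (cases n) auto
  obtain ys where ys: "distinct ys" "set ys = partitions N m"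
    using finite_distinct_list[OF finite_partitions] by metis
  define ts where "ts = map (inc 0) ys"
  define xs where "xs = ps @ ts"
  have set_ts: "set ts = inc 0 ` partitions N m" by (simp add: ts_def ys)
  have disj: "set ps \<inter> set ts = {}"
    using partitions_Suc(2)[OF assms(1), of m] by (simp add: assms(5) set_ts n)
  have xs: "distinct xs" "set xs = partitions N n"
    using disj partitions_Suc(1)[OF assms(1), of m] assms(4) ys(1)
    by (auto simp: xs_def ts_def distinct_map inj_inc assms(5) ys(2) n)
  have P: "\<mu> \<in> partitions N n" if "\<mu> \<in> set ps \<or> \<mu> \<in> set ts" for \<mu>
    using that xs(2) by (auto simp: xs_def)
  let ?A = "\<lambda>\<nu> \<mu>. coef (tmsym N \<mu>) \<nu>" and ?c = "orbit_norm N \<kappa>"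
  \<comment> \<open>The Gram matrix of the \<open>tmsym\<close> for the pairing in which the
    \<open>msym\<close> are orthogonal with squared norms \<open>orbit_norm\<close>.\<close>
  define Gm where "Gm \<mu> \<rho> = (\<Sum>\<nu>\<in>partitions N n. ?A \<nu> \<mu> * ?c \<nu> * ?A \<nu> \<rho>)" for \<mu> \<rho>
  define L where "L \<nu> \<mu> = (if \<mu> \<in> set ps then B N \<mu> \<nu> else ?c \<nu> * ?A \<nu> \<mu>)" for \<nu> \<mu>
  define g where "g = det (lmat ts ts Gm)"
  have c: "?c \<nu> > 0" if "\<nu> \<in> partitions N n" for n \<nu> using orbit_norm_pos[OF assms(3) that] .
  have AB: "(\<Sum>\<nu>\<in>partitions N n. ?A \<nu> \<rho> * B N \<mu> \<nu>) = (if \<mu> = \<rho> then 1 else 0)"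
    if "\<mu> \<in> partitions N n" "\<rho> \<in> partitions N n" for \<mu> \<rho>
    using B_mult_tmsym[OF assms(1) that] by (simp add: mult.commute)

  \<comment> \<open>Multiplying by A^T costs nothing, as its determinant is 1. By duality the
    columns belonging to \<open>ps\<close> become unit vectors, so only the Gram block over
    \<open>ts\<close> survives.\<close>
  have "det (lmat xs xs L) = det (lmat xs xs (\<lambda>\<mu> \<rho>. \<Sum>\<nu>\<in>set xs. ?A \<nu> \<mu> * L \<nu> \<rho>))"
    by (simp only: det_lmat_mult[OF xs(1)] det_lmat_transpose[of xs ?A]
        det_tmsym[OF assms(1) xs] mult_1_left)
  also have "\<dots> = det (lmat ps ps (\<lambda>\<mu> \<rho>. \<Sum>\<nu>\<in>set xs. ?A \<nu> \<mu> * L \<nu> \<rho>)) *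
      det (lmat ts ts (\<lambda>\<mu> \<rho>. \<Sum>\<nu>\<in>set xs. ?A \<nu> \<mu> * L \<nu> \<rho>))"
    unfolding xs(2) unfolding xs_def
    by (rule det_lmat_block_triangular) (use disj P AB in \<open>auto simp: L_def\<close>)
  also have "lmat ps ps (\<lambda>\<mu> \<rho>. \<Sum>\<nu>\<in>set xs. ?A \<nu> \<mu> * L \<nu> \<rho>) = 1\<^sub>m (length ps)"
    unfolding lmat_one[OF assms(4), symmetric]
    by (rule lmat_cong) (use P AB in \<open>auto simp: L_def xs(2)\<close>)
  also have "lmat ts ts (\<lambda>\<mu> \<rho>. \<Sum>\<nu>\<in>set xs. ?A \<nu> \<mu> * L \<nu> \<rho>) = lmat ts ts Gm"
    by (rule lmat_cong) (use disj in \<open>auto simp: L_def xs(2) Gm_def mult.assoc intro!: sum.cong\<close>)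
  finally have det_L: "det (lmat xs xs L) = g" by (simp add: g_def)

  \<comment> \<open>With inverse weights inserted, the block over \<open>ps\<close> is the wanted
    Gram matrix and the block over \<open>ts\<close> is again \<open>Gm\<close>. The inverse weights
    themselves have determinant \<open>D N \<kappa> n\<close>.\<close>
  let ?K = "\<lambda>\<mu> \<rho>. \<Sum>\<nu>\<in>set xs. L \<nu> \<mu> * (inverse (?c \<nu>) * L \<nu> \<rho>)"
  have "det (lmat xs xs ?K) = det (lmat xs xs (\<lambda>\<mu> \<nu>. L \<nu> \<mu>)) *
      det (lmat xs xs (\<lambda>\<nu> \<rho>. inverse (?c \<nu>) * L \<nu> \<rho>))"
    by (rule det_lmat_mult[OF xs(1)])
  also have "\<dots> = g * (D N \<kappa> n * g)"
    by (simp only: det_lmat_transpose[of xs L] det_lmat_scale_rows[OF xs(1)]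
        det_L xs(2) D_eq prod_inversef[symmetric] o_def)
  finally have "det (lmat xs xs ?K) = g * (D N \<kappa> n * g)" .
  moreover have "det (lmat xs xs ?K) = det (lmat ps ps ?K) * det (lmat ts ts ?K)"
    unfolding xs(2) unfolding xs_def
  proof (rule det_lmat_block_triangular)
    fix \<mu> \<rho> assume \<mu>: "\<mu> \<in> set ts" and \<rho>: "\<rho> \<in> set ps"
    then have ne: "\<mu> \<notin> set ps" "\<mu> \<noteq> \<rho>" using disj by auto
    have "(\<Sum>\<nu>\<in>partitions N n. L \<nu> \<mu> * (inverse (?c \<nu>) * L \<nu> \<rho>)) =
        (\<Sum>\<nu>\<in>partitions N n. ?A \<nu> \<mu> * B N \<rho> \<nu>)"
      using ne \<rho> c by (intro sum.cong refl) (simp add: L_def less_imp_neq[symmetric])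
    then show "(\<Sum>\<nu>\<in>partitions N n. L \<nu> \<mu> * (inverse (?c \<nu>) * L \<nu> \<rho>)) = 0"
      using AB[of \<rho> \<mu>] P \<mu> \<rho> ne by simp
  qed
  moreover have "lmat ts ts ?K = lmat ts ts Gm"
  proof (rule lmat_cong)
    fix \<mu> \<rho> assume "\<mu> \<in> set ts" "\<rho> \<in> set ts"
    then have "\<mu> \<notin> set ps" "\<rho> \<notin> set ps" using disj by auto
    then show "?K \<mu> \<rho> = Gm \<mu> \<rho>"
      using c unfolding Gm_def xs(2) by (intro sum.cong refl) (simp add: L_def less_imp_neq[symmetric])
  qed
  moreover have "lmat ps ps ?K = gram_matrix (inner_h N \<kappa>) (map (h N \<kappa>) ps)"
  proof -
    have "gram_matrix (inner_h N \<kappa>) (map (h N \<kappa>) ps) =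
        lmat ps ps (\<lambda>\<mu> \<rho>. inner_h N \<kappa> (h N \<kappa> \<mu>) (h N \<kappa> \<rho>))"
      by (rule eq_matI) (auto simp: gram_matrix_def)
    also have "\<dots> = lmat ps ps ?K"
      by (rule lmat_cong) (use P in \<open>simp add: inner_h_h[OF assms(1,3)] L_def xs(2) field_simps\<close>)
    finally show ?thesis ..
  qed
  ultimately have gram: "det (gram_matrix (inner_h N \<kappa>) (map (h N \<kappa>) ps)) * g = g * (D N \<kappa> n * g)"
    unfolding g_def by metis

  let ?a = "\<lambda>i. (real i + 1) * (2 * real m - real i + real N * (\<kappa> + 1/2))"
  have "g = inverse (D N \<kappa> m) * det (lmat ys ys (\<lambda>\<nu> \<mu>. lowering N \<kappa> (raising N (orbit_ind N \<mu>)) \<nu>))"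
    unfolding g_def ts_def lmat_map Gm_def n by (subst det_raised_gram[OF assms(1) ys]) (simp add: D_eq)
  also have "det (lmat ys ys (\<lambda>\<nu> \<mu>. lowering N \<kappa> (raising N (orbit_ind N \<mu>)) \<nu>)) =
      (\<Prod>i<n. ?a i ^ d (m - i) N)"
    using det_lowering_raising[OF assms(1,3) ys, of 0] by (simp add: n cong: if_cong)
  finally have g: "g = inverse (D N \<kappa> m) * (\<Prod>i<n. ?a i ^ d (m - i) N)" .
  have "D N \<kappa> m > 0" unfolding D_eq using c by (intro positive_imp_inverse_positive prod_pos)
  moreover have "(\<Prod>i<n. ?a i ^ d (m - i) N) > 0"
  proof (rule prod_pos, rule zero_less_power)
    fix i assume "i \<in> {..<n}"
    then have "real i \<le> real m" by (simp add: n)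
    moreover have "real N * (\<kappa> + 1/2) > 0" using assms(1,3) by simp
    ultimately show "?a i > 0" by (intro mult_pos_pos) auto
  qed
  \<comment> \<open>The identity \<open>gram\<close> has g once on the left and twice on the right;
    positivity allows one factor to be cancelled.\<close>
  ultimately have "g > 0" unfolding g by (simp only: mult_pos_pos positive_imp_inverse_positive)
  then have "det (gram_matrix (inner_h N \<kappa>) (map (h N \<kappa>) ps)) = D N \<kappa> n * g" using gram by simp
  also have "D N \<kappa> n * g = D N \<kappa> n / D N \<kappa> m * (\<Prod>i<n. ?a i ^ d (m - i) N)"
    by (simp only: g divide_inverse mult.assoc)
  also have "(\<Prod>i<n. ?a i ^ d (m - i) N) =
      (\<Prod>i=1..n. (real i * (2 * real n - real i - 1 + real N / 2 + real N * \<kappa>)) ^ d (n - i) N)"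
    \<comment> \<open>The shifts start in degree m = n - 1 and are counted from 0, so the factor
      \<open>?a i\<close> belongs to i + 1 in the product of the statement.\<close>
    unfolding One_nat_def prod.atLeast1_atMost_eq
    by (intro prod.cong refl) (simp add: n algebra_simps)
  finally show ?thesis by (simp only: n diff_Suc_1)
qed



end
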